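(* Let $\mathcal O$ be an off-branch family in the ground model $V$, let $\mathbb P$ be the forcing notion whose underlying set is ${}^{<\omega}\omega$, ordered by $p\le q$ iff $p\supseteq q$ (i.e. $p$ end-extends $q$), and let $G$ be $\mathbb P$-generic over $V$. Then in $V[G]$, $\mathcal O$ is not a maximal off-branch family.
   Context: Let ${}^{<\omega}\omega$ be the tree of finite sequences of natural numbers ordered by initial segment; a branch is a maximal linearly ordered set of nodes. Two infinite sets are almost disjoint if their intersection is finite. An infinite set $A$ of nodes is off-branch if $A$ is almost disjoint from every branch; an off-branch family is a pairwise almost disjoint family of off-branch sets, maximal if no off-branch set is almost disjoint from all of its members. In $V[G]$ these notions are evaluated in $V[G]$ (with all branches of ${}^{<\omega}\omega$ existing in $V[G]$). *)

theory Defs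
  imports Main
begin

text \<open>First-order formulas of the language of set theory. Variables are natural numbers;
  \<open>All i \<phi>\<close> binds the variable \<open>i\<close>.\<close>

datatype fm =
    Member nat nat
  | Equal nat nat
  | Neg fm
  | Conj fm fm
  | All nat fm

text \<open>A structure for the language of set theory: domain \<open>M\<close>, membership \<open>E\<close>. There are no
  assumptions. The set-theoretic and combinatorial notions are the usual first-order definitions
  with all quantifiers relativised to \<open>M\<close>, i.e. the notions as evaluated in \<open>(M, E)\<close>; only
  \<open>transitive\<close> and the notions concerning generic extensions look at \<open>M\<close> from outside.\<close>

locale set_structure =
  fixes M :: "'a set"
    and E :: "'a \<Rightarrow> 'a \<Rightarrow> bool"  (infix "\<in>\<^sub>E" 50)
begin

definition subset :: "'a \<Rightarrow> 'a \<Rightarrow> bool" where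
  "subset a b \<longleftrightarrow> (\<forall>x\<in>M. x \<in>\<^sub>E a \<longrightarrow> x \<in>\<^sub>E b)"

definition is_empty :: "'a \<Rightarrow> bool" where
  "is_empty a \<longleftrightarrow> (\<forall>x\<in>M. \<not> x \<in>\<^sub>E a)"

definition is_upair :: "'a \<Rightarrow> 'a \<Rightarrow> 'a \<Rightarrow> bool" where
  "is_upair a b c \<longleftrightarrow> (\<forall>x\<in>M. x \<in>\<^sub>E c \<longleftrightarrow> x = a \<or> x = b)"

text \<open>\<open>c\<close> is the Kuratowski pair of \<open>a\<close> and \<open>b\<close>.\<close>

definition is_opair :: "'a \<Rightarrow> 'a \<Rightarrow> 'a \<Rightarrow> bool" where
  "is_opair a b c \<longleftrightarrow> (\<exists>u\<in>M. \<exists>v\<in>M. is_upair a a u \<and> is_upair a b v \<and> is_upair u v c)"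

definition is_inter :: "'a \<Rightarrow> 'a \<Rightarrow> 'a \<Rightarrow> bool" where
  "is_inter a b c \<longleftrightarrow> (\<forall>x\<in>M. x \<in>\<^sub>E c \<longleftrightarrow> x \<in>\<^sub>E a \<and> x \<in>\<^sub>E b)"

definition is_succ :: "'a \<Rightarrow> 'a \<Rightarrow> bool" where
  "is_succ a b \<longleftrightarrow> (\<forall>x\<in>M. x \<in>\<^sub>E b \<longleftrightarrow> x \<in>\<^sub>E a \<or> x = a)"

definition is_inductive :: "'a \<Rightarrow> bool" where
  "is_inductive u \<longleftrightarrow>
     (\<exists>z\<in>M. is_empty z \<and> z \<in>\<^sub>E u) \<and>
     (\<forall>x\<in>M. x \<in>\<^sub>E u \<longrightarrow> (\<exists>y\<in>M. is_succ x y \<and> y \<in>\<^sub>E u))"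

definition is_omega :: "'a \<Rightarrow> bool" where
  "is_omega w \<longleftrightarrow> is_inductive w \<and> (\<forall>u\<in>M. is_inductive u \<longrightarrow> subset w u)"

definition is_natural :: "'a \<Rightarrow> bool" where
  "is_natural n \<longleftrightarrow> (\<exists>w\<in>M. is_omega w \<and> n \<in>\<^sub>E w)"

definition maps_to :: "'a \<Rightarrow> 'a \<Rightarrow> 'a \<Rightarrow> bool" where
  "maps_to f x y \<longleftrightarrow> (\<exists>z\<in>M. is_opair x y z \<and> z \<in>\<^sub>E f)"

definition is_function :: "'a \<Rightarrow> 'a \<Rightarrow> 'a \<Rightarrow> bool" where
  "is_function f a b \<longleftrightarrow>
     (\<forall>z\<in>M. z \<in>\<^sub>E f \<longrightarrow> (\<exists>x\<in>M. \<exists>y\<in>M. x \<in>\<^sub>E a \<and> y \<in>\<^sub>E b \<and> is_opair x y z)) \<and>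
     (\<forall>x\<in>M. x \<in>\<^sub>E a \<longrightarrow> (\<exists>!y. y \<in> M \<and> maps_to f x y))"

definition is_bijection :: "'a \<Rightarrow> 'a \<Rightarrow> 'a \<Rightarrow> bool" where
  "is_bijection f a b \<longleftrightarrow>
     is_function f a b \<and> (\<forall>y\<in>M. y \<in>\<^sub>E b \<longrightarrow> (\<exists>!x. x \<in> M \<and> maps_to f x y))"

definition is_finite :: "'a \<Rightarrow> bool" where
  "is_finite a \<longleftrightarrow> (\<exists>n\<in>M. \<exists>f\<in>M. is_natural n \<and> is_bijection f n a)"

primrec sat :: "fm \<Rightarrow> (nat \<Rightarrow> 'a) \<Rightarrow> bool" where
  "sat (Member i j) \<rho> \<longleftrightarrow> \<rho> i \<in>\<^sub>E \<rho> j"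
| "sat (Equal i j) \<rho> \<longleftrightarrow> \<rho> i = \<rho> j"
| "sat (Neg \<phi>) \<rho> \<longleftrightarrow> \<not> sat \<phi> \<rho>"
| "sat (Conj \<phi> \<psi>) \<rho> \<longleftrightarrow> sat \<phi> \<rho> \<and> sat \<psi> \<rho>"
| "sat (All i \<phi>) \<rho> \<longleftrightarrow> (\<forall>a\<in>M. sat \<phi> (\<rho>(i := a)))"

definition extensionality_ax :: bool where
  "extensionality_ax \<longleftrightarrow> (\<forall>a\<in>M. \<forall>b\<in>M. (\<forall>x\<in>M. x \<in>\<^sub>E a \<longleftrightarrow> x \<in>\<^sub>E b) \<longrightarrow> a = b)"

definition foundation_ax :: bool where
  "foundation_ax \<longleftrightarrow>
     (\<forall>a\<in>M. (\<exists>x\<in>M. x \<in>\<^sub>E a) \<longrightarrow> (\<exists>x\<in>M. x \<in>\<^sub>E a \<and> (\<forall>y\<in>M. y \<in>\<^sub>E x \<longrightarrow> \<not> y \<in>\<^sub>E a)))"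

definition pairing_ax :: bool where
  "pairing_ax \<longleftrightarrow> (\<forall>a\<in>M. \<forall>b\<in>M. \<exists>c\<in>M. is_upair a b c)"

definition union_ax :: bool where
  "union_ax \<longleftrightarrow> (\<forall>a\<in>M. \<exists>b\<in>M. \<forall>x\<in>M. x \<in>\<^sub>E b \<longleftrightarrow> (\<exists>y\<in>M. x \<in>\<^sub>E y \<and> y \<in>\<^sub>E a))"

definition power_ax :: bool where
  "power_ax \<longleftrightarrow> (\<forall>a\<in>M. \<exists>b\<in>M. \<forall>x\<in>M. x \<in>\<^sub>E b \<longleftrightarrow> subset x a)"

definition infinity_ax :: bool where
  "infinity_ax \<longleftrightarrow> (\<exists>u\<in>M. is_inductive u)"

text \<open>In the two schemes, the variable 0 is the argument, 1 is the value, and \<open>\<rho>\<close> supplies the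
  parameters.\<close>

definition separation_ax :: bool where
  "separation_ax \<longleftrightarrow>
     (\<forall>\<phi> \<rho>. range \<rho> \<subseteq> M \<longrightarrow>
        (\<forall>a\<in>M. \<exists>b\<in>M. \<forall>x\<in>M. x \<in>\<^sub>E b \<longleftrightarrow> x \<in>\<^sub>E a \<and> sat \<phi> (\<rho>(0 := x))))"

definition replacement_ax :: bool where
  "replacement_ax \<longleftrightarrow>
     (\<forall>\<phi> \<rho>. range \<rho> \<subseteq> M \<longrightarrow>
        (\<forall>a\<in>M. (\<forall>x\<in>M. x \<in>\<^sub>E a \<longrightarrow> (\<exists>!y. y \<in> M \<and> sat \<phi> (\<rho>(0 := x, 1 := y)))) \<longrightarrow>
           (\<exists>b\<in>M. \<forall>y\<in>M. y \<in>\<^sub>E b \<longleftrightarrow> (\<exists>x\<in>M. x \<in>\<^sub>E a \<and> sat \<phi> (\<rho>(0 := x, 1 := y))))))"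

definition choice_ax :: bool where
  "choice_ax \<longleftrightarrow>
     (\<forall>a\<in>M. (\<forall>x\<in>M. x \<in>\<^sub>E a \<longrightarrow> \<not> is_empty x) \<and>
        (\<forall>x\<in>M. \<forall>y\<in>M. x \<in>\<^sub>E a \<and> y \<in>\<^sub>E a \<and> x \<noteq> y \<longrightarrow> \<not> (\<exists>z\<in>M. z \<in>\<^sub>E x \<and> z \<in>\<^sub>E y)) \<longrightarrow>
        (\<exists>c\<in>M. \<forall>x\<in>M. x \<in>\<^sub>E a \<longrightarrow> (\<exists>!z. z \<in> M \<and> z \<in>\<^sub>E x \<and> z \<in>\<^sub>E c)))"

definition models_ZFC :: bool where
  "models_ZFC \<longleftrightarrow>
     M \<noteq> {} \<and> extensionality_ax \<and> foundation_ax \<and> pairing_ax \<and> union_ax \<and> power_ax \<and>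
     infinity_ax \<and> separation_ax \<and> replacement_ax \<and> choice_ax"

definition transitive :: bool where
  "transitive \<longleftrightarrow> (\<forall>x\<in>M. \<forall>y. y \<in>\<^sub>E x \<longrightarrow> y \<in> M)"

text \<open>A node is a function from a natural number to \<open>\<omega>\<close>; initial segment is \<open>subset\<close>.\<close>

definition node :: "'a \<Rightarrow> bool" where
  "node s \<longleftrightarrow> (\<exists>n\<in>M. \<exists>w\<in>M. is_natural n \<and> is_omega w \<and> is_function s n w)"

definition node_set :: "'a \<Rightarrow> bool" where
  "node_set A \<longleftrightarrow> (\<forall>s\<in>M. s \<in>\<^sub>E A \<longrightarrow> node s)"

definition chain :: "'a \<Rightarrow> bool" where
  "chain C \<longleftrightarrow>
     node_set C \<and> (\<forall>s\<in>M. \<forall>t\<in>M. s \<in>\<^sub>E C \<and> t \<in>\<^sub>E C \<longrightarrow> subset s t \<or> subset t s)"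

definition branch :: "'a \<Rightarrow> bool" where
  "branch B \<longleftrightarrow> chain B \<and> (\<forall>C\<in>M. chain C \<and> subset B C \<longrightarrow> C = B)"

definition almost_disjoint :: "'a \<Rightarrow> 'a \<Rightarrow> bool" where
  "almost_disjoint A B \<longleftrightarrow> (\<exists>c\<in>M. is_inter A B c \<and> is_finite c)"

definition off_branch :: "'a \<Rightarrow> bool" where
  "off_branch A \<longleftrightarrow>
     node_set A \<and> \<not> is_finite A \<and> (\<forall>B\<in>M. branch B \<longrightarrow> almost_disjoint A B)"

definition off_branch_family :: "'a \<Rightarrow> bool" where
  "off_branch_family F \<longleftrightarrow>
     (\<forall>A\<in>M. A \<in>\<^sub>E F \<longrightarrow> off_branch A) \<and>
     (\<forall>A\<in>M. \<forall>B\<in>M. A \<in>\<^sub>E F \<and> B \<in>\<^sub>E F \<and> A \<noteq> B \<longrightarrow> almost_disjoint A B)"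

definition maximal_off_branch_family :: "'a \<Rightarrow> bool" where
  "maximal_off_branch_family F \<longleftrightarrow>
     off_branch_family F \<and>
     \<not> (\<exists>X\<in>M. off_branch X \<and> (\<forall>A\<in>M. A \<in>\<^sub>E F \<longrightarrow> almost_disjoint X A))"

text \<open>Here \<open>M\<close> plays the role of the ground model. A filter \<open>G\<close> on the forcing notion
  \<open>(P, le)\<close>, where \<open>le p q\<close> means that \<open>p\<close> is stronger, is generic if it meets every dense
  subset of \<open>P\<close> that is an element of \<open>M\<close>; \<open>G\<close> itself need not be one.\<close>

definition dense_in :: "'a set \<Rightarrow> ('a \<Rightarrow> 'a \<Rightarrow> bool) \<Rightarrow> 'a \<Rightarrow> bool" where
  "dense_in P le D \<longleftrightarrow>
     (\<forall>d\<in>M. d \<in>\<^sub>E D \<longrightarrow> d \<in> P) \<and> (\<forall>p\<in>P. \<exists>d\<in>M. d \<in>\<^sub>E D \<and> le d p)"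

definition generic_filter :: "'a set \<Rightarrow> ('a \<Rightarrow> 'a \<Rightarrow> bool) \<Rightarrow> 'a set \<Rightarrow> bool" where
  "generic_filter P le G \<longleftrightarrow>
     G \<subseteq> P \<and> G \<noteq> {} \<and>
     (\<forall>p\<in>G. \<forall>q\<in>P. le p q \<longrightarrow> q \<in> G) \<and>
     (\<forall>p\<in>G. \<forall>q\<in>G. \<exists>r\<in>G. le r p \<and> le r q) \<and>
     (\<forall>D\<in>M. dense_in P le D \<longrightarrow> (\<exists>p\<in>G. p \<in>\<^sub>E D))"

inductive is_name :: "'a set \<Rightarrow> 'a \<Rightarrow> bool" for P where
  "\<tau> \<in> M \<Longrightarrow>
   (\<forall>z\<in>M. z \<in>\<^sub>E \<tau> \<longrightarrow> (\<exists>\<sigma>. \<exists>p\<in>P. is_opair \<sigma> p z \<and> is_name P \<sigma>)) \<Longrightarrow>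
   is_name P \<tau>"

text \<open>\<open>is_value G \<tau> x\<close> says \<open>x = {val\<^sub>G \<sigma> | \<sigma>. \<exists>p\<in>G. (\<sigma>, p) \<in> \<tau>}\<close>, the value of the name \<open>\<tau>\<close>. The
  value lives in the ambient structure \<open>(UNIV, E)\<close>, hence \<open>x\<close> and \<open>y\<close> are not restricted to \<open>M\<close>.
  If \<open>E\<close> is well-founded and extensional, a name has at most one value.\<close>

inductive is_value :: "'a set \<Rightarrow> 'a \<Rightarrow> 'a \<Rightarrow> bool" for G where
  "(\<forall>z\<in>M. \<forall>\<sigma>\<in>M. \<forall>p\<in>G. z \<in>\<^sub>E \<tau> \<and> is_opair \<sigma> p z \<longrightarrow> (\<exists>y. y \<in>\<^sub>E x \<and> is_value G \<sigma> y)) \<Longrightarrow>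
   (\<forall>y. y \<in>\<^sub>E x \<longrightarrow> (\<exists>z\<in>M. \<exists>\<sigma>\<in>M. \<exists>p\<in>G. z \<in>\<^sub>E \<tau> \<and> is_opair \<sigma> p z \<and> is_value G \<sigma> y)) \<Longrightarrow>
   is_value G \<tau> x"

text \<open>\<open>N\<close> is the generic extension \<open>M[G] = {val\<^sub>G \<tau> | \<tau>. \<tau> a P-name in M}\<close>. The first conjunct
  includes that every name does have a value, which the ambient structure need not
  guarantee otherwise.\<close>

definition is_generic_extension :: "'a set \<Rightarrow> 'a set \<Rightarrow> 'a set \<Rightarrow> bool" where
  "is_generic_extension P G N \<longleftrightarrow>
     (\<forall>\<tau>. is_name P \<tau> \<longrightarrow> (\<exists>x\<in>N. is_value G \<tau> x)) \<and>
     (\<forall>x\<in>N. \<exists>\<tau>. is_name P \<tau> \<and> is_value G \<tau> x)"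

text \<open>The underlying set is taken as an external set of elements of \<open>M\<close>; the stronger
  condition is the longer sequence.\<close>

definition seq_poset :: "'a set" where
  "seq_poset = {p \<in> M. node p}"

definition seq_le :: "'a \<Rightarrow> 'a \<Rightarrow> bool" where
  "seq_le p q \<longleftrightarrow> subset q p"

end

end

theory Submission
  imports Defs "HOL-Library.Sublist"
begin

text \<open>Let \<open>g\<close> be the generic branch and \<open>X\<close> the set of all nodes \<open>q @ [0]\<close> such that
  \<open>q @ [1]\<close> lies on \<open>g\<close>. It is an infinite antichain, hence off-branch, and all but finitely many
  of its members extend any given initial segment of \<open>g\<close>. If \<open>A \<in> \<O>\<close> is off-branch in \<open>V[G]\<close>, then
  \<open>F = A \<inter> g\<close> is finite and so belongs to \<open>V\<close>. The nodes that lie in \<open>A - F\<close> or have no extension in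
  \<open>A - F\<close> form a dense set of \<open>V\<close>; by genericity some \<open>p\<close> on \<open>g\<close> has no extension in \<open>A - F\<close>, and
  \<open>A \<inter> X\<close> is finite. If some member of \<open>\<O>\<close> is no longer off-branch in \<open>V[G]\<close>, there is nothing to
  prove, so no branch has to be constructed inside \<open>V\<close>.

  Only hereditarily finite sets need check names. The combinatorial notions are absolute because
  in any transitive model that contains \<open>\<omega>\<close> and is closed under finite subsets they can be
  computed from the outside, in terms of \<open>nat list\<close> and \<open>finite\<close>.\<close>

section \<open>First-order definability\<close>

text \<open>Bound variables are renamed together with the free ones, so an injective renaming cannot
  cause capture.\<close>

primrec ren :: "(nat \<Rightarrow> nat) \<Rightarrow> fm \<Rightarrow> fm" where
  "ren \<pi> (Member i j) = Member (\<pi> i) (\<pi> j)"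
| "ren \<pi> (Equal i j) = Equal (\<pi> i) (\<pi> j)"
| "ren \<pi> (Neg \<phi>) = Neg (ren \<pi> \<phi>)"
| "ren \<pi> (Conj \<phi> \<psi>) = Conj (ren \<pi> \<phi>) (ren \<pi> \<psi>)"
| "ren \<pi> (All i \<phi>) = All (\<pi> i) (ren \<pi> \<phi>)"

primrec vars :: "fm \<Rightarrow> nat set" where
  "vars (Member i j) = {i, j}"
| "vars (Equal i j) = {i, j}"
| "vars (Neg \<phi>) = vars \<phi>"
| "vars (Conj \<phi> \<psi>) = vars \<phi> \<union> vars \<psi>"
| "vars (All i \<phi>) = insert i (vars \<phi>)"

lemma finite_vars: "finite (vars \<phi>)"
  by (induction \<phi>) auto

context set_structure
begin

lemma sat_ren: "inj \<pi> \<Longrightarrow> sat (ren \<pi> \<phi>) \<rho> \<longleftrightarrow> sat \<phi> (\<rho> \<circ> \<pi>)"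
proof (induction \<phi> arbitrary: \<rho>)
  case (All i \<phi>)
  have "\<rho>(\<pi> i := a) \<circ> \<pi> = (\<rho> \<circ> \<pi>)(i := a)" for a
    by (rule ext) (simp add: inj_eq[OF All.prems])
  then show ?case
    by (simp only: ren.simps sat.simps All.IH[OF All.prems])
qed auto

lemma sat_cong: "(\<And>i. i \<in> vars \<phi> \<Longrightarrow> \<rho> i = \<rho>' i) \<Longrightarrow> sat \<phi> \<rho> \<longleftrightarrow> sat \<phi> \<rho>'"
proof (induction \<phi> arbitrary: \<rho> \<rho>')
  case (Neg \<phi>)
  have "sat \<phi> \<rho> \<longleftrightarrow> sat \<phi> \<rho>'"
    by (rule Neg.IH) (use Neg.prems in simp)
  then show ?case
    by simp
next
  case (Conj \<phi> \<psi>)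
  have "sat \<phi> \<rho> \<longleftrightarrow> sat \<phi> \<rho>'" "sat \<psi> \<rho> \<longleftrightarrow> sat \<psi> \<rho>'"
    by (rule Conj.IH; use Conj.prems in simp)+
  then show ?case
    by simp
next
  case (All i \<phi>)
  have "sat \<phi> (\<rho>(i := a)) \<longleftrightarrow> sat \<phi> (\<rho>'(i := a))" for a
    by (rule All.IH) (use All.prems in auto)
  then show ?case
    by simp
qed auto

definition definable :: "((nat \<Rightarrow> 'a) \<Rightarrow> bool) \<Rightarrow> bool" where
  "definable Q \<longleftrightarrow> (\<exists>\<phi>. \<forall>\<rho>. range \<rho> \<subseteq> M \<longrightarrow> sat \<phi> \<rho> \<longleftrightarrow> Q \<rho>)"

named_theorems dfb

lemma definable_mem [dfb]: "definable (\<lambda>\<rho>. \<rho> i \<in>\<^sub>E \<rho> j)"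
  unfolding definable_def by (rule exI[of _ "Member i j"]) simp

lemma definable_eq [dfb]: "definable (\<lambda>\<rho>. \<rho> i = \<rho> j)"
  unfolding definable_def by (rule exI[of _ "Equal i j"]) simp

lemma definable_not [dfb]: "definable Q \<Longrightarrow> definable (\<lambda>\<rho>. \<not> Q \<rho>)"
  unfolding definable_def by (elim exE, rule_tac x = "Neg \<phi>" in exI) simp

lemma definable_conj [dfb]:
  "definable Q \<Longrightarrow> definable R \<Longrightarrow> definable (\<lambda>\<rho>. Q \<rho> \<and> R \<rho>)"
  unfolding definable_def by (elim exE, rule_tac x = "Conj \<phi> \<phi>'" in exI) simp

lemma definable_disj [dfb]:
  "definable Q \<Longrightarrow> definable R \<Longrightarrow> definable (\<lambda>\<rho>. Q \<rho> \<or> R \<rho>)"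
  using definable_not[OF definable_conj[OF definable_not definable_not, of Q R]] by simp

lemma definable_imp [dfb]:
  "definable Q \<Longrightarrow> definable R \<Longrightarrow> definable (\<lambda>\<rho>. Q \<rho> \<longrightarrow> R \<rho>)"
  using definable_disj[OF definable_not, of Q R] by (simp only: imp_conv_disj)

lemma definable_iff [dfb]:
  "definable Q \<Longrightarrow> definable R \<Longrightarrow> definable (\<lambda>\<rho>. Q \<rho> \<longleftrightarrow> R \<rho>)"
  using definable_conj[OF definable_imp definable_imp, of Q R R Q]
  by (simp only: iff_conv_conj_imp)

text \<open>The quantified variable is passed de Bruijn style, as the new entry 0 of the assignment.
  Since formulas have named variables, the renaming moves it to a variable \<open>k\<close> that does not
  occur.\<close>

lemma definable_ball [dfb]:
  assumes "definable (\<lambda>\<rho>. Q (\<lambda>i. \<rho> (Suc i)) (\<rho> 0))"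
  shows "definable (\<lambda>\<rho>. \<forall>x\<in>M. Q \<rho> x)"
proof -
  obtain \<phi> where \<phi>: "\<And>\<rho>. range \<rho> \<subseteq> M \<Longrightarrow> sat \<phi> \<rho> \<longleftrightarrow> Q (\<lambda>i. \<rho> (Suc i)) (\<rho> 0)"
    using assms unfolding definable_def by blast
  obtain k where k: "\<And>i. i \<in> vars \<phi> \<Longrightarrow> i \<le> k"
    using finite_vars[of \<phi>] by (metis finite_nat_set_iff_bounded_le)
  \<comment> \<open>A cyclic permutation of the indices up to \<open>k\<close>: it sends 0 to
    \<open>k\<close> and shifts the others down. On \<open>vars \<phi>\<close>, which lies below the
    bound, \<open>\<rho>(k := a)\<close> after \<open>\<pi>\<close> agrees with
    \<open>case_nat a \<rho>\<close>.\<close>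
  define \<pi> where "\<pi> i = (if i = 0 then k else if i \<le> k then i - 1 else i)" for i
  have inj: "inj \<pi>"
    by (rule injI) (auto simp: \<pi>_def split: if_splits)
  have "sat (All k (ren \<pi> \<phi>)) \<rho> \<longleftrightarrow> (\<forall>x\<in>M. Q \<rho> x)" if \<rho>: "range \<rho> \<subseteq> M" for \<rho>
  proof -
    have "sat (ren \<pi> \<phi>) (\<rho>(k := a)) \<longleftrightarrow> Q \<rho> a" if "a \<in> M" for a
    proof -
      have "sat (ren \<pi> \<phi>) (\<rho>(k := a)) \<longleftrightarrow> sat \<phi> (case_nat a \<rho>)"
        unfolding sat_ren[OF inj]
        by (rule sat_cong) (use k in \<open>force simp: \<pi>_def split: nat.split\<close>)
      also have "range (case_nat a \<rho>) \<subseteq> M"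
        using that range_subsetD[OF \<rho>] by (auto split: nat.split)
      then have "sat \<phi> (case_nat a \<rho>) \<longleftrightarrow> Q \<rho> a"
        by (simp add: \<phi>)
      finally show ?thesis .
    qed
    then show ?thesis
      by simp
  qed
  then show ?thesis
    unfolding definable_def by blast
qed

lemma definable_bex [dfb]:
  assumes "definable (\<lambda>\<rho>. Q (\<lambda>i. \<rho> (Suc i)) (\<rho> 0))"
  shows "definable (\<lambda>\<rho>. \<exists>x\<in>M. Q \<rho> x)"
  using definable_not[OF definable_ball[OF definable_not[OF assms]]] by simp

lemma definable_bex1 [dfb]:
  assumes "definable (\<lambda>\<rho>. \<exists>x\<in>M. Q \<rho> x \<and> (\<forall>y\<in>M. Q \<rho> y \<longrightarrow> y = x))"
  shows "definable (\<lambda>\<rho>. \<exists>!x. x \<in> M \<and> Q \<rho> x)"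
proof -
  have "(\<exists>!x. x \<in> M \<and> Q \<rho> x) \<longleftrightarrow> (\<exists>x\<in>M. Q \<rho> x \<and> (\<forall>y\<in>M. Q \<rho> y \<longrightarrow> y = x))" for \<rho>
    by blast
  then show ?thesis
    using assms by simp
qed

section \<open>Definability of the set-theoretic notions\<close>

lemma definable_subset [dfb]: "definable (\<lambda>\<rho>. subset (\<rho> i) (\<rho> j))"
  unfolding subset_def by (intro dfb)

lemma definable_is_empty [dfb]: "definable (\<lambda>\<rho>. is_empty (\<rho> i))"
  unfolding is_empty_def by (intro dfb)

lemma definable_is_upair [dfb]: "definable (\<lambda>\<rho>. is_upair (\<rho> i) (\<rho> j) (\<rho> k))"
  unfolding is_upair_def by (intro dfb)

lemma definable_is_opair [dfb]: "definable (\<lambda>\<rho>. is_opair (\<rho> i) (\<rho> j) (\<rho> k))"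
  unfolding is_opair_def by (intro dfb)

lemma definable_is_succ [dfb]: "definable (\<lambda>\<rho>. is_succ (\<rho> i) (\<rho> j))"
  unfolding is_succ_def by (intro dfb)

lemma definable_is_inductive [dfb]: "definable (\<lambda>\<rho>. is_inductive (\<rho> i))"
  unfolding is_inductive_def by (intro dfb)

lemma definable_is_omega [dfb]: "definable (\<lambda>\<rho>. is_omega (\<rho> i))"
  unfolding is_omega_def by (intro dfb)

lemma definable_is_natural [dfb]: "definable (\<lambda>\<rho>. is_natural (\<rho> i))"
  unfolding is_natural_def by (intro dfb)

lemma definable_maps_to [dfb]: "definable (\<lambda>\<rho>. maps_to (\<rho> i) (\<rho> j) (\<rho> k))"
  unfolding maps_to_def by (intro dfb)

lemma definable_is_function [dfb]: "definable (\<lambda>\<rho>. is_function (\<rho> i) (\<rho> j) (\<rho> k))"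
  unfolding is_function_def by (intro dfb)

lemma definable_node [dfb]: "definable (\<lambda>\<rho>. node (\<rho> i))"
  unfolding node_def by (intro dfb)

lemma separation:
  assumes separation_ax "definable (\<lambda>\<rho>. Q (\<rho> 0) (\<rho> 1) (\<rho> 2) (\<rho> 3))"
    and "a \<in> M" "p \<in> M" "q \<in> M" "r \<in> M"
  obtains b where "b \<in> M" "\<And>x. x \<in> M \<Longrightarrow> x \<in>\<^sub>E b \<longleftrightarrow> x \<in>\<^sub>E a \<and> Q x p q r"
proof -
  obtain \<phi> where \<phi>: "\<And>\<rho>. range \<rho> \<subseteq> M \<Longrightarrow> sat \<phi> \<rho> \<longleftrightarrow> Q (\<rho> 0) (\<rho> 1) (\<rho> 2) (\<rho> 3)"
    using assms(2) unfolding definable_def by blast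
  \<comment> \<open>Entry 0 will be overwritten by the argument; every entry from 3 on may be
    \<open>r\<close>, since the predicate reads only the first four.\<close>
  define \<rho> where "\<rho> = (\<lambda>i :: nat. if i = 1 then p else if i = 2 then q else r)"
  have \<rho>: "range \<rho> \<subseteq> M"
    using assms by (auto simp: \<rho>_def)
  obtain b where b: "b \<in> M" "\<forall>x\<in>M. x \<in>\<^sub>E b \<longleftrightarrow> x \<in>\<^sub>E a \<and> sat \<phi> (\<rho>(0 := x))"
    using assms(1,3) \<rho> unfolding separation_ax_def by blast
  have "sat \<phi> (\<rho>(0 := x)) \<longleftrightarrow> Q x p q r" if "x \<in> M" for x
    using \<rho> that by (subst \<phi>) (auto simp: \<rho>_def)
  then show ?thesis
    using b that by blast
qed

lemma replacement:
  assumes replacement_ax "definable (\<lambda>\<rho>. Q (\<rho> 0) (\<rho> 1) (\<rho> 2))"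
    and "a \<in> M" "p \<in> M"
    and fn: "\<And>x. x \<in> M \<Longrightarrow> x \<in>\<^sub>E a \<Longrightarrow> \<exists>!y. y \<in> M \<and> Q x y p"
  obtains b where "b \<in> M" "\<And>y. y \<in> M \<Longrightarrow> y \<in>\<^sub>E b \<longleftrightarrow> (\<exists>x\<in>M. x \<in>\<^sub>E a \<and> Q x y p)"
proof -
  obtain \<phi> where \<phi>: "\<And>\<rho>. range \<rho> \<subseteq> M \<Longrightarrow> sat \<phi> \<rho> \<longleftrightarrow> Q (\<rho> 0) (\<rho> 1) (\<rho> 2)"
    using assms(2) unfolding definable_def by blast
  define \<rho> where "\<rho> = (\<lambda>i :: nat. p)"
  have \<rho>: "range \<rho> \<subseteq> M"
    using assms by (auto simp: \<rho>_def)
  have sat: "sat \<phi> (\<rho>(0 := x, 1 := y)) \<longleftrightarrow> Q x y p" if "x \<in> M" "y \<in> M" for x y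
    using \<rho> that by (subst \<phi>) (auto simp: \<rho>_def)
  have "\<exists>b\<in>M. \<forall>y\<in>M. y \<in>\<^sub>E b \<longleftrightarrow> (\<exists>x\<in>M. x \<in>\<^sub>E a \<and> sat \<phi> (\<rho>(0 := x, 1 := y)))"
  proof -
    have "\<forall>x\<in>M. x \<in>\<^sub>E a \<longrightarrow> (\<exists>!y. y \<in> M \<and> sat \<phi> (\<rho>(0 := x, 1 := y)))"
    proof (intro ballI impI)
      fix x assume x: "x \<in> M" "x \<in>\<^sub>E a"
      have "(y \<in> M \<and> sat \<phi> (\<rho>(0 := x, 1 := y))) \<longleftrightarrow> (y \<in> M \<and> Q x y p)" for y
        using sat x by blast
      then show "\<exists>!y. y \<in> M \<and> sat \<phi> (\<rho>(0 := x, 1 := y))"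
        using fn[OF x] by presburger
    qed
    then show ?thesis
      using assms(1,3) \<rho> unfolding replacement_ax_def by blast
  qed
  then obtain b where b: "b \<in> M"
      "\<And>y. y \<in> M \<Longrightarrow> y \<in>\<^sub>E b \<longleftrightarrow> (\<exists>x\<in>M. x \<in>\<^sub>E a \<and> sat \<phi> (\<rho>(0 := x, 1 := y)))"
    by blast
  show ?thesis
    by (rule that[OF b(1)]) (simp only: b(2) sat cong: bex_cong conj_cong)
qed

end

section \<open>Transitive models containing the hereditarily finite sets\<close>

text \<open>The codings below refer to \<open>E\<close> alone, so the ground model and its extension
  share the same \<open>num n\<close> and \<open>enc xs\<close>. Absoluteness rests on this.\<close>

locale ambient =
  fixes E :: "'a \<Rightarrow> 'a \<Rightarrow> bool"  (infix "\<in>\<^sub>E" 50)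
  assumes wf: "wfp E"
    and ext: "(\<And>z. z \<in>\<^sub>E x \<longleftrightarrow> z \<in>\<^sub>E y) \<Longrightarrow> x = y"
begin

definition elts :: "'a \<Rightarrow> 'a set" where
  "elts x = {z. z \<in>\<^sub>E x}"

lemma in_elts [simp]: "z \<in> elts x \<longleftrightarrow> z \<in>\<^sub>E x"
  by (simp add: elts_def)

lemma elts_eq_iff: "elts x = A \<longleftrightarrow> (\<forall>z. z \<in>\<^sub>E x \<longleftrightarrow> z \<in> A)"
  by (auto simp: elts_def)

lemma elts_inject: "elts x = elts y \<longleftrightarrow> x = y"
  using ext by (auto simp: elts_def)

lemma E_induct [case_names step]: "(\<And>x. (\<And>y. y \<in>\<^sub>E x \<Longrightarrow> P y) \<Longrightarrow> P x) \<Longrightarrow> P x"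
  using wf by (metis wfp_induct)

lemma not_E_self: "\<not> x \<in>\<^sub>E x"
  by (induction x rule: E_induct) blast

text \<open>\<open>mk A\<close> is only meaningful for sets \<open>A\<close> represented in the ambient structure.\<close>

definition mk :: "'a set \<Rightarrow> 'a" where
  "mk A = (SOME x. elts x = A)"

lemma mk_elts [simp]: "mk (elts x) = x"
  unfolding mk_def by (simp add: elts_inject)

lemma elts_mk_eq: "elts x = A \<Longrightarrow> elts (mk A) = A"
  by auto

definition opair :: "'a \<Rightarrow> 'a \<Rightarrow> 'a" where
  "opair a b = mk {mk {a}, mk {a, b}}"

primrec num :: "nat \<Rightarrow> 'a" where
  "num 0 = mk {}"
| "num (Suc n) = mk (insert (num n) (elts (num n)))"

text \<open>The graph of the list as a function on its length: internal nodes will turn out to be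
  exactly these codes, with initial segment becoming inclusion.\<close>

definition enc :: "nat list \<Rightarrow> 'a" where
  "enc xs = mk ((\<lambda>i. opair (num i) (num (xs ! i))) ` {..<length xs})"

inductive hf :: "'a \<Rightarrow> bool" where
  "finite (elts x) \<Longrightarrow> (\<And>y. y \<in>\<^sub>E x \<Longrightarrow> hf y) \<Longrightarrow> hf x"

end

text \<open>Weak enough to be checked directly for the generic extension, so that neither the
  forcing theorem nor the preservation of ZFC is required.\<close>

locale fin_model = set_structure M E + ambient E
  for M :: "'a set" and E :: "'a \<Rightarrow> 'a \<Rightarrow> bool"  (infix "\<in>\<^sub>E" 50) +
  assumes trans: transitive
    and fin: "finite A \<Longrightarrow> A \<subseteq> M \<Longrightarrow> \<exists>x\<in>M. elts x = A"
begin

lemma E_in_M [dest]: "x \<in>\<^sub>E y \<Longrightarrow> y \<in> M \<Longrightarrow> x \<in> M"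
  using trans unfolding transitive_def by blast

lemma mk_in_M [simp]: "finite A \<Longrightarrow> A \<subseteq> M \<Longrightarrow> mk A \<in> M"
  using fin mk_elts by metis

lemma elts_mk [simp]: "finite A \<Longrightarrow> A \<subseteq> M \<Longrightarrow> elts (mk A) = A"
  using fin elts_mk_eq by metis

lemma E_mk [simp]: "finite A \<Longrightarrow> A \<subseteq> M \<Longrightarrow> x \<in>\<^sub>E mk A \<longleftrightarrow> x \<in> A"
  using elts_mk in_elts by metis

lemma mk_inject:
  "finite A \<Longrightarrow> A \<subseteq> M \<Longrightarrow> finite B \<Longrightarrow> B \<subseteq> M \<Longrightarrow> mk A = mk B \<longleftrightarrow> A = B"
  using elts_mk by metis

lemma eq_mk_iff: "finite A \<Longrightarrow> A \<subseteq> M \<Longrightarrow> x = mk A \<longleftrightarrow> elts x = A"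
  by (metis elts_mk mk_elts)

section \<open>Absoluteness of the elementary notions\<close>

lemma subset_iff: "a \<in> M \<Longrightarrow> subset a b \<longleftrightarrow> elts a \<subseteq> elts b"
  unfolding subset_def using E_in_M by auto

lemma is_empty_iff: "a \<in> M \<Longrightarrow> is_empty a \<longleftrightarrow> a = mk {}"
  unfolding is_empty_def by (subst eq_mk_iff) (auto simp: elts_eq_iff)

lemma is_upair_iff: "a \<in> M \<Longrightarrow> b \<in> M \<Longrightarrow> c \<in> M \<Longrightarrow> is_upair a b c \<longleftrightarrow> c = mk {a, b}"
  unfolding is_upair_def by (subst eq_mk_iff) (auto simp: elts_eq_iff)

lemma opair_in_M [simp]: "a \<in> M \<Longrightarrow> b \<in> M \<Longrightarrow> opair a b \<in> M"
  unfolding opair_def by simp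

lemma is_opair_iff: "a \<in> M \<Longrightarrow> b \<in> M \<Longrightarrow> c \<in> M \<Longrightarrow> is_opair a b c \<longleftrightarrow> c = opair a b"
  unfolding is_opair_def opair_def by (simp add: is_upair_iff)

lemma opair_inject [simp]:
  assumes "a \<in> M" "b \<in> M" "c \<in> M" "d \<in> M"
  shows "opair a b = opair c d \<longleftrightarrow> a = c \<and> b = d"
proof -
  have "{mk {a}, mk {a, b}} = {mk {c}, mk {c, d}} \<longleftrightarrow> a = c \<and> b = d"
    using assms by (subst doubleton_eq_iff) (auto simp: mk_inject doubleton_eq_iff)
  then show ?thesis
    unfolding opair_def using assms by (subst mk_inject) simp_all
qed

lemma is_inter_iff: "c \<in> M \<Longrightarrow> a \<in> M \<Longrightarrow> is_inter a b c \<longleftrightarrow> elts c = elts a \<inter> elts b"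
  unfolding is_inter_def by (auto simp: elts_eq_iff)

lemma is_succ_iff:
  "a \<in> M \<Longrightarrow> b \<in> M \<Longrightarrow> is_succ a b \<longleftrightarrow> elts b = insert a (elts a)"
  unfolding is_succ_def by (auto simp: elts_eq_iff)

section \<open>Natural numbers and finite sequences as sets\<close>

lemma num_aux: "num n \<in> M \<and> elts (num n) = num ` {..<n}"
proof (induction n)
  case (Suc n)
  then have "insert (num n) (num ` {..<n}) \<subseteq> M"
    using E_in_M in_elts by blast
  then show ?case
    using Suc by (simp add: lessThan_Suc)
qed simp

lemma num_in_M [simp]: "num n \<in> M"
  and elts_num: "elts (num n) = num ` {..<n}"
  using num_aux by auto

text \<open>For \<open>m < n\<close> the set \<open>num m\<close> is an element of
  \<open>num n\<close>, and by well-foundedness no set is an element of itself.\<close>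

lemma num_inject [simp]: "num m = num n \<longleftrightarrow> m = n"
proof -
  have "num m \<noteq> num n" if "m < n" for m n
    using that elts_num[of n] in_elts[of "num m" "num n"] not_E_self by (metis imageI lessThan_iff)
  then show ?thesis
    by (metis linorder_neqE_nat)
qed

lemma num_E_num: "x \<in>\<^sub>E num n \<longleftrightarrow> (\<exists>i<n. x = num i)"
  using elts_num[of n] in_elts[of x "num n"] by auto

lemma is_empty_num_0: "is_empty (num 0)"
  by (simp add: is_empty_iff)

lemma is_succ_num: "y \<in> M \<Longrightarrow> is_succ (num n) y \<longleftrightarrow> y = num (Suc n)"
  by (subst is_succ_iff) (auto simp: elts_num lessThan_Suc eq_mk_iff elts_inject[symmetric] simp del: num.simps)

lemma is_inductive_num:
  assumes "is_inductive u" "u \<in> M"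
  shows "num n \<in>\<^sub>E u"
proof (induction n)
  case 0
  then show ?case
    using assms unfolding is_inductive_def by (auto simp: is_empty_iff)
next
  case (Suc n)
  then show ?case
    using assms is_succ_num num_in_M unfolding is_inductive_def by metis
qed

lemma enc_pairs_in_M [simp]: "(\<lambda>i. opair (num i) (num (xs ! i))) ` {..<length xs} \<subseteq> M"
  by auto

lemma enc_in_M [simp]: "enc xs \<in> M"
  unfolding enc_def by simp

lemma elts_enc: "elts (enc xs) = (\<lambda>i. opair (num i) (num (xs ! i))) ` {..<length xs}"
  unfolding enc_def by simp

lemma E_enc: "z \<in>\<^sub>E enc xs \<longleftrightarrow> (\<exists>i<length xs. z = opair (num i) (num (xs ! i)))"
  unfolding enc_def by auto

lemma opair_E_enc: "opair (num i) (num k) \<in>\<^sub>E enc xs \<longleftrightarrow> i < length xs \<and> xs ! i = k"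
  by (auto simp: E_enc)

lemma subset_enc_iff: "subset (enc xs) (enc ys) \<longleftrightarrow> prefix xs ys"
proof
  assume "subset (enc xs) (enc ys)"
  then have "opair (num i) (num (xs ! i)) \<in>\<^sub>E enc ys" if "i < length xs" for i
    using that opair_E_enc[of i "xs ! i" xs] unfolding subset_def by auto
  then have *: "i < length ys \<and> xs ! i = ys ! i" if "i < length xs" for i
    using that by (simp add: opair_E_enc)
  then have "length xs \<le> length ys"
    by (meson leI less_irrefl)
  then have "xs = take (length xs) ys"
    using * by (intro nth_equalityI) auto
  then show "prefix xs ys"
    by (metis take_is_prefix)
next
  assume "prefix xs ys"
  then show "subset (enc xs) (enc ys)"
    by (auto simp: subset_iff elts_enc prefix_def nth_append simp del: in_elts)
qed

text \<open>Equal codes include each other, so antisymmetry of \<open>prefix\<close>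
  applies.\<close>

lemma enc_inject [simp]: "enc xs = enc ys \<longleftrightarrow> xs = ys"
  using subset_enc_iff[of xs ys] subset_enc_iff[of ys xs] subset_enc_iff[of xs xs]
  by (metis prefix_order.antisym prefix_order.refl)

text \<open>This is the form in which a first-order formula can speak of appending a digit;
  \<open>sibling\<close> relies on it.\<close>

lemma elts_enc_snoc:
  "elts (enc (xs @ [k])) = insert (opair (num (length xs)) (num k)) (elts (enc xs))"
proof -
  have "(\<lambda>i. opair (num i) (num ((xs @ [k]) ! i))) ` {..<length xs} = elts (enc xs)"
    unfolding elts_enc by (rule image_cong) (auto simp: nth_append)
  then show ?thesis
    by (simp add: elts_enc[of "xs @ [k]"] lessThan_Suc)
qed

lemma hf_mk: "finite A \<Longrightarrow> A \<subseteq> M \<Longrightarrow> (\<And>x. x \<in> A \<Longrightarrow> hf x) \<Longrightarrow> hf (mk A)"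
  by (rule hf.intros) simp_all

lemma hf_opair: "a \<in> M \<Longrightarrow> b \<in> M \<Longrightarrow> hf a \<Longrightarrow> hf b \<Longrightarrow> hf (opair a b)"
  unfolding opair_def by (intro hf_mk) (auto intro: hf_mk)

lemma hf_num: "hf (num n)"
proof (induction n rule: less_induct)
  case (less n)
  then show ?case
    by (intro hf.intros[of "num n"]) (auto simp: elts_num num_E_num)
qed

lemma hf_enc: "hf (enc xs)"
  unfolding enc_def by (intro hf_mk) (auto intro: hf_opair hf_num)

end

section \<open>Functions, finiteness and almost disjointness computed from outside\<close>

locale omega_model = fin_model M E
  for M :: "'a set" and E :: "'a \<Rightarrow> 'a \<Rightarrow> bool"  (infix "\<in>\<^sub>E" 50) +
  assumes omega_ex: "\<exists>w\<in>M. elts w = range num"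
begin

definition omega :: 'a where
  "omega = mk (range num)"

lemma omega_in_M [simp]: "omega \<in> M"
  using omega_ex unfolding omega_def by (metis mk_elts)

lemma elts_omega: "elts omega = range num"
  using omega_ex elts_mk_eq unfolding omega_def by metis

lemma E_omega: "x \<in>\<^sub>E omega \<longleftrightarrow> x \<in> range num"
  using elts_omega in_elts by metis

lemma is_inductive_omega: "is_inductive omega"
  unfolding is_inductive_def
proof (intro conjI ballI impI)
  show "\<exists>z\<in>M. is_empty z \<and> z \<in>\<^sub>E omega"
    using is_empty_num_0 E_omega num_in_M by blast
next
  fix x assume "x \<in>\<^sub>E omega"
  then obtain n where "x = num n"
    by (auto simp: E_omega)
  then show "\<exists>y\<in>M. is_succ x y \<and> y \<in>\<^sub>E omega"
    using is_succ_num[of "num (Suc n)" n] E_omega num_in_M by blast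
qed

text \<open>\<open>omega\<close> is inductive and contained in every inductive set of the model, so
  extensionality leaves no other candidate.\<close>

lemma is_omega_iff: "w \<in> M \<Longrightarrow> is_omega w \<longleftrightarrow> w = omega"
proof
  assume w: "w \<in> M" "is_omega w"
  then have "elts w \<subseteq> range num"
    using is_inductive_omega elts_omega unfolding is_omega_def
    by (metis omega_in_M subset_iff)
  moreover have "range num \<subseteq> elts w"
    using w is_inductive_num by (auto simp: is_omega_def)
  ultimately show "w = omega"
    by (metis elts_inject elts_omega subset_antisym)
next
  assume "w \<in> M" "w = omega"
  moreover have "elts omega \<subseteq> elts u" if "is_inductive u" "u \<in> M" for u
    using is_inductive_num[OF that] by (auto simp: E_omega)
  ultimately show "is_omega w"
    using is_inductive_omega by (simp add: is_omega_def subset_iff)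
qed

lemma is_natural_iff: "is_natural n \<longleftrightarrow> n \<in> range num"
  unfolding is_natural_def using is_omega_iff E_omega omega_in_M by metis

lemma maps_to_iff: "x \<in> M \<Longrightarrow> y \<in> M \<Longrightarrow> f \<in> M \<Longrightarrow> maps_to f x y \<longleftrightarrow> opair x y \<in>\<^sub>E f"
  unfolding maps_to_def by (auto simp: is_opair_iff)

lemma is_function_opairD:
  assumes "is_function f a b" "opair x y \<in>\<^sub>E f" "x \<in> M" "y \<in> M"
  shows "x \<in>\<^sub>E a \<and> y \<in>\<^sub>E b"
proof -
  obtain x' y' where "x' \<in> M" "y' \<in> M" "x' \<in>\<^sub>E a" "y' \<in>\<^sub>E b" "is_opair x' y' (opair x y)"
    using assms opair_in_M[of x y] unfolding is_function_def by blast
  then show ?thesis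
    using assms by (simp add: is_opair_iff)
qed

lemma is_function_enc: "is_function (enc xs) (num (length xs)) omega"
proof -
  have "\<exists>x\<in>M. \<exists>y\<in>M. x \<in>\<^sub>E num (length xs) \<and> y \<in>\<^sub>E omega \<and> is_opair x y z"
    if z: "z \<in>\<^sub>E enc xs" for z
  proof -
    obtain i where "i < length xs" "z = opair (num i) (num (xs ! i))"
      using z by (auto simp: E_enc)
    then show ?thesis
      by (intro bexI[of _ "num i"] bexI[of _ "num (xs ! i)"])
        (auto simp: num_E_num E_omega is_opair_iff)
  qed
  moreover have "\<exists>!y. y \<in> M \<and> maps_to (enc xs) x y" if x: "x \<in>\<^sub>E num (length xs)" for x
  proof -
    obtain i where i: "i < length xs" "x = num i"
      using x by (auto simp: num_E_num)
    have "opair (num i) y \<in>\<^sub>E enc xs \<longleftrightarrow> y = num (xs ! i)" if "y \<in> M" for y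
      using that i by (auto simp: E_enc)
    then show ?thesis
      using i by (intro ex1I[of _ "num (xs ! i)"]) (auto simp: maps_to_iff)
  qed
  ultimately show ?thesis
    unfolding is_function_def by blast
qed

text \<open>An internal function on \<open>num n\<close> is determined by finitely many values, each
  some \<open>num k\<close>, and these form a list. Hence all models of this kind have the same
  nodes.\<close>

lemma is_function_iff:
  assumes f: "f \<in> M"
  shows "is_function f (num n) omega \<longleftrightarrow> (\<exists>xs. length xs = n \<and> f = enc xs)"
proof
  assume fn: "is_function f (num n) omega"
  \<comment> \<open>Existence and uniqueness of the value are merged into one equivalence, from
    which the function \<open>k\<close> is then chosen.\<close>
  have "\<exists>k. \<forall>y\<in>M. opair (num i) y \<in>\<^sub>E f \<longleftrightarrow> y = num k" if i: "i < n" for i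
  proof -
    have "\<exists>!y. y \<in> M \<and> opair (num i) y \<in>\<^sub>E f"
    proof -
      have "\<exists>!y. y \<in> M \<and> maps_to f (num i) y"
        using fn i unfolding is_function_def by (auto simp: num_E_num)
      moreover have "y \<in> M \<and> maps_to f (num i) y \<longleftrightarrow> y \<in> M \<and> opair (num i) y \<in>\<^sub>E f" for y
        using f by (auto simp: maps_to_iff)
      ultimately show ?thesis
        by simp
    qed
    then obtain y where y: "y \<in> M" "opair (num i) y \<in>\<^sub>E f"
        "\<And>y'. y' \<in> M \<Longrightarrow> opair (num i) y' \<in>\<^sub>E f \<Longrightarrow> y' = y"
      by blast
    have "y \<in>\<^sub>E omega"
      using is_function_opairD[OF fn y(2)] y(1) by simp
    then obtain k where "y = num k"
      unfolding E_omega by blast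
    then show ?thesis
      using y by (intro exI[of _ k]) blast
  qed
  then obtain k where k: "\<And>i y. i < n \<Longrightarrow> y \<in> M \<Longrightarrow> opair (num i) y \<in>\<^sub>E f \<longleftrightarrow> y = num (k i)"
    by metis
  have "elts f = elts (enc (map k [0..<n]))"
  proof (intro equalityI subsetI)
    fix z assume "z \<in> elts f"
    then have z: "z \<in>\<^sub>E f"
      by simp
    then obtain a b where "a \<in> M" "b \<in> M" "a \<in>\<^sub>E num n" "z = opair a b"
      using fn f E_in_M[OF z] unfolding is_function_def by (metis is_opair_iff)
    then show "z \<in> elts (enc (map k [0..<n]))"
      using k z by (auto simp: num_E_num elts_enc simp del: in_elts)
  next
    fix z assume "z \<in> elts (enc (map k [0..<n]))"
    then show "z \<in> elts f"
      using k by (auto simp: elts_enc simp del: in_elts) auto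
  qed
  then show "\<exists>xs. length xs = n \<and> f = enc xs"
    unfolding elts_inject by (intro exI[of _ "map k [0..<n]"]) simp
qed (use is_function_enc in blast)

lemma node_iff: "s \<in> M \<Longrightarrow> node s \<longleftrightarrow> s \<in> range enc"
proof -
  assume s: "s \<in> M"
  have "node s \<longleftrightarrow> (\<exists>n. is_function s (num n) omega)"
    unfolding node_def by (force simp: is_natural_iff is_omega_iff)
  then show ?thesis
    using s by (auto simp: is_function_iff)
qed

text \<open>Choosing for each element of \<open>a\<close> an index below \<open>n\<close> that is
  mapped to it gives an injection into \<open>{..<n}\<close>, because \<open>f\<close> is
  single-valued.\<close>

lemma is_bijection_finite:
  assumes "f \<in> M" "a \<in> M" "is_bijection f (num n) a"
  shows "finite (elts a)"
proof -
  have "\<exists>i. i < n \<and> maps_to f (num i) y" if "y \<in>\<^sub>E a" for y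
  proof -
    have y: "y \<in> M"
      using that assms by blast
    then have "\<exists>!x. x \<in> M \<and> maps_to f x y"
      using that assms(3) by (simp add: is_bijection_def)
    then obtain x where x: "x \<in> M" "maps_to f x y"
      by (elim ex1E conjE)
    then have "opair x y \<in>\<^sub>E f"
      using y assms by (simp add: maps_to_iff)
    then have "x \<in>\<^sub>E num n"
      using assms(3) x(1) y is_function_opairD[of f "num n" a x y]
      by (simp add: is_bijection_def)
    then show ?thesis
      using x by (auto simp: num_E_num)
  qed
  moreover have "y = y'" if "i < n" "maps_to f (num i) y" "maps_to f (num i) y'" "y \<in> M" "y' \<in> M" for i y y'
    using that assms unfolding is_bijection_def is_function_def by (metis num_E_num num_in_M)
  ultimately have "\<exists>i. i < n \<and> maps_to f (num i) y \<and> (\<forall>y'. y' \<in>\<^sub>E a \<longrightarrow> maps_to f (num i) y' \<longrightarrow> y' = y)"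
    if "y \<in>\<^sub>E a" for y
    using that E_in_M assms(2) by metis
  then obtain g where g: "\<And>y. y \<in>\<^sub>E a \<Longrightarrow> g y < n \<and> maps_to f (num (g y)) y \<and>
      (\<forall>y'. y' \<in>\<^sub>E a \<longrightarrow> maps_to f (num (g y)) y' \<longrightarrow> y' = y)"
    by metis
  then have "inj_on g (elts a)" "g ` elts a \<subseteq> {..<n}"
    by (auto intro!: inj_onI) metis
  then show ?thesis
    using finite_subset inj_on_finite by blast
qed

lemma is_finite_iff:
  assumes a: "a \<in> M"
  shows "is_finite a \<longleftrightarrow> finite (elts a)"
proof
  assume "is_finite a"
  then show "finite (elts a)"
    using a is_bijection_finite by (auto simp: is_finite_def is_natural_iff)
next
  assume "finite (elts a)"
  then obtain h where "bij_betw h {0..<card (elts a)} (elts a)"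
    using ex_bij_betw_nat_finite by blast
  moreover define n where "n = card (elts a)"
  ultimately have h: "bij_betw h {..<n} (elts a)"
    by (simp add: atLeast0LessThan)
  have hM: "h i \<in> M" if "i < n" for i
    using bij_betwE[OF h] that a by auto
  \<comment> \<open>The external enumeration \<open>h\<close> becomes internal: its graph is a
    finite subset of \<open>M\<close>, hence represented in \<open>M\<close>.\<close>
  define f where "f = mk ((\<lambda>i. opair (num i) (h i)) ` {..<n})"
  have f: "f \<in> M" "elts f = (\<lambda>i. opair (num i) (h i)) ` {..<n}"
    unfolding f_def by (subst mk_in_M elts_mk; use hM in auto)+
  have Ef: "z \<in>\<^sub>E f \<longleftrightarrow> (\<exists>i<n. z = opair (num i) (h i))" for z
    using f(2) in_elts[of z f] by auto
  have maps: "maps_to f x y \<longleftrightarrow> (\<exists>i<n. x = num i \<and> y = h i)" if "x \<in> M" "y \<in> M" for x y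
    using that hM f(1) by (auto simp: maps_to_iff Ef)
  have h_E: "h i \<in>\<^sub>E a" if "i < n" for i
    using bij_betwE[OF h] that by auto
  have "is_function f (num n) a"
    unfolding is_function_def
  proof (intro conjI ballI impI)
    fix z assume "z \<in>\<^sub>E f"
    then obtain i where "i < n" "z = opair (num i) (h i)"
      by (auto simp: Ef)
    then show "\<exists>x\<in>M. \<exists>y\<in>M. x \<in>\<^sub>E num n \<and> y \<in>\<^sub>E a \<and> is_opair x y z"
      using hM h_E by (intro bexI[of _ "num i"] bexI[of _ "h i"]) (auto simp: num_E_num is_opair_iff)
  next
    fix x assume "x \<in>\<^sub>E num n"
    then obtain i where i: "i < n" "x = num i"
      by (auto simp: num_E_num)
    then show "\<exists>!y. y \<in> M \<and> maps_to f x y"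
      using hM by (intro ex1I[of _ "h i"]) (auto simp: maps)
  qed
  moreover have "\<exists>!x. x \<in> M \<and> maps_to f x y" if y: "y \<in> M" "y \<in>\<^sub>E a" for y
  proof -
    obtain i where i: "i < n" "y = h i"
      using bij_betw_imp_surj_on[OF h] y(2) in_elts by blast
    moreover have "j = i" if "j < n" "h j = h i" for j
      using h i that unfolding bij_betw_def inj_on_def by auto
    ultimately show ?thesis
      using y maps num_in_M by (intro ex1I[of _ "num i"]) metis+
  qed
  ultimately have "is_bijection f (num n) a"
    unfolding is_bijection_def by blast
  then show "is_finite a"
    unfolding is_finite_def is_natural_iff using f(1) num_in_M by blast
qed

text \<open>The definition asks for the intersection as an element of \<open>M\<close>. When it is
  finite, closure under finite subsets supplies it without separation.\<close>

lemma almost_disjoint_iff: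
  assumes "A \<in> M" "B \<in> M"
  shows "almost_disjoint A B \<longleftrightarrow> finite (elts A \<inter> elts B)"
proof
  assume "almost_disjoint A B"
  then show "finite (elts A \<inter> elts B)"
    using assms by (auto simp: almost_disjoint_def is_inter_iff is_finite_iff)
next
  assume *: "finite (elts A \<inter> elts B)"
  moreover have "elts A \<inter> elts B \<subseteq> M"
    using assms by auto
  ultimately show "almost_disjoint A B"
    using assms unfolding almost_disjoint_def
    by (intro bexI[of _ "mk (elts A \<inter> elts B)"]) (simp_all add: is_inter_iff is_finite_iff)
qed

lemma node_set_iff: "A \<in> M \<Longrightarrow> node_set A \<longleftrightarrow> elts A \<subseteq> range enc"
  unfolding node_set_def using node_iff E_in_M by auto

end

section \<open>Transitive models of ZFC\<close>

locale zfc_model = set_structure M E + ambient E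
  for M :: "'a set" and E :: "'a \<Rightarrow> 'a \<Rightarrow> bool"  (infix "\<in>\<^sub>E" 50) +
  assumes transitive_M: transitive
    and zfc: models_ZFC
begin

lemma mem_in_M: "x \<in>\<^sub>E y \<Longrightarrow> y \<in> M \<Longrightarrow> x \<in> M"
  using transitive_M unfolding transitive_def by blast

lemma sep:
  assumes "definable (\<lambda>\<rho>. Q (\<rho> 0) (\<rho> 1) (\<rho> 2) (\<rho> 3))"
    and "a \<in> M" "p \<in> M" "q \<in> M" "r \<in> M"
  obtains b where "b \<in> M" "elts b = {x. x \<in>\<^sub>E a \<and> Q x p q r}"
proof -
  have separation_ax
    using zfc by (simp add: models_ZFC_def)
  then obtain b where "b \<in> M" "\<And>x. x \<in> M \<Longrightarrow> x \<in>\<^sub>E b \<longleftrightarrow> x \<in>\<^sub>E a \<and> Q x p q r"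
    using separation[OF _ assms] by blast
  then show ?thesis
    using that[of b] assms(2) mem_in_M by (auto simp: elts_eq_iff)
qed

lemma union:
  assumes "a \<in> M" "b \<in> M"
  obtains c where "c \<in> M" "elts c = elts a \<union> elts b"
proof -
  have pairing_ax union_ax
    using zfc by (simp_all add: models_ZFC_def)
  obtain u where u: "u \<in> M" "is_upair a b u"
    using \<open>pairing_ax\<close> assms unfolding pairing_ax_def by blast
  have "\<exists>c\<in>M. \<forall>x\<in>M. x \<in>\<^sub>E c \<longleftrightarrow> (\<exists>y\<in>M. x \<in>\<^sub>E y \<and> y \<in>\<^sub>E u)"
    using \<open>union_ax\<close> u(1) unfolding union_ax_def by (rule bspec)
  then obtain c where c: "c \<in> M" "\<forall>x\<in>M. x \<in>\<^sub>E c \<longleftrightarrow> (\<exists>y\<in>M. x \<in>\<^sub>E y \<and> y \<in>\<^sub>E u)"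
    by (elim bexE)
  have "x \<in>\<^sub>E c \<longleftrightarrow> x \<in>\<^sub>E a \<or> x \<in>\<^sub>E b" if "x \<in> M" for x
    using bspec[OF c(2) that] u(2) assms unfolding is_upair_def by auto
  then have "elts c = elts a \<union> elts b"
    using c(1) assms mem_in_M by (auto simp: elts_eq_iff)
  then show ?thesis
    using that c(1) by blast
qed

text \<open>Separation with a false formula gives the empty set; pairing and union then add one
  element at a time.\<close>

lemma finite_in_M: "finite A \<Longrightarrow> A \<subseteq> M \<Longrightarrow> \<exists>x\<in>M. elts x = A"
proof (induction A rule: finite_induct)
  case empty
  obtain a where a: "a \<in> M"
    using zfc by (auto simp: models_ZFC_def)
  have "definable (\<lambda>\<rho>. \<rho> 0 \<noteq> \<rho> 0)"
    by (intro dfb)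
  then obtain b where "b \<in> M" "elts b = {x. x \<in>\<^sub>E a \<and> x \<noteq> x}"
    by (rule sep[where Q = "\<lambda>x _ _ _. x \<noteq> x", OF _ a a a a]) blast
  then show ?case
    by auto
next
  case (insert a A)
  then obtain x where x: "x \<in> M" "elts x = A"
    by blast
  have "pairing_ax"
    using zfc by (simp add: models_ZFC_def)
  then obtain y where "y \<in> M" "is_upair a a y"
    using insert.prems unfolding pairing_ax_def by blast
  then have y: "y \<in> M" "elts y = {a}"
    using insert.prems mem_in_M unfolding is_upair_def by (auto simp: elts_eq_iff)
  obtain z where "z \<in> M" "elts z = elts y \<union> elts x"
    using union[OF y(1) x(1)] by blast
  then show ?case
    using x y by (auto intro!: bexI[of _ z])
qed

sublocale fin_model M E
  by unfold_locales (use transitive_M finite_in_M in auto)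

text \<open>Let \<open>w\<close> be the intersection of all inductive sets of \<open>M\<close>. If
  some element of \<open>w\<close> were not a \<open>num n\<close>, an \<open>E\<close>-minimal such
  \<open>x\<close> could be removed and \<open>w\<close> without \<open>x\<close> would still be
  inductive.\<close>

lemma omega_in_model: "\<exists>w\<in>M. elts w = range num"
proof -
  have infinity_ax
    using zfc by (simp add: models_ZFC_def)
  then obtain u where u: "u \<in> M" "is_inductive u"
    unfolding infinity_ax_def by blast
  have "definable (\<lambda>\<rho>. \<forall>i\<in>M. is_inductive i \<longrightarrow> \<rho> 0 \<in>\<^sub>E i)"
    by (intro dfb)
  then obtain w where w: "w \<in> M" "elts w = {x. x \<in>\<^sub>E u \<and> (\<forall>i\<in>M. is_inductive i \<longrightarrow> x \<in>\<^sub>E i)}"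
    by (rule sep[where Q = "\<lambda>x _ _ _. \<forall>i\<in>M. is_inductive i \<longrightarrow> x \<in>\<^sub>E i", OF _ u(1) u(1) u(1) u(1)])
      blast
  have Ew: "x \<in>\<^sub>E w \<longleftrightarrow> (\<forall>i\<in>M. is_inductive i \<longrightarrow> x \<in>\<^sub>E i)" for x
    using w(2) u unfolding elts_eq_iff by blast
  have "x \<in>\<^sub>E w \<longrightarrow> x \<in> range num" for x
  proof (induction x rule: E_induct)
    case (step x)
    show ?case
    proof (rule ccontr)
      assume contra: "\<not> (x \<in>\<^sub>E w \<longrightarrow> x \<in> range num)"
      then have x: "x \<in>\<^sub>E w" "x \<in> M" "x \<notin> range num"
        using w(1) by auto
      have "definable (\<lambda>\<rho>. \<rho> 0 \<noteq> \<rho> 1)"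
        by (intro dfb)
      then obtain v where v: "v \<in> M" "elts v = {y. y \<in>\<^sub>E w \<and> y \<noteq> x}"
        by (rule sep[where Q = "\<lambda>y x _ _. y \<noteq> x", OF _ w(1) x(2) x(2) x(2)]) blast
      then have Ev: "y \<in>\<^sub>E v \<longleftrightarrow> y \<in>\<^sub>E w \<and> y \<noteq> x" for y
        by (simp add: elts_eq_iff)
      have "is_inductive v"
        unfolding is_inductive_def
      proof (intro conjI ballI impI)
        have "num 0 \<in>\<^sub>E v"
          using x is_inductive_num unfolding Ev Ew by blast
        then show "\<exists>z\<in>M. is_empty z \<and> z \<in>\<^sub>E v"
          using is_empty_num_0 num_in_M by blast
      next
        fix y assume y: "y \<in> M" "y \<in>\<^sub>E v"
        then have "y \<in>\<^sub>E w"
          by (simp add: Ev)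
        then have "\<forall>i\<in>M. is_inductive i \<longrightarrow> (\<exists>z\<in>M. is_succ y z \<and> z \<in>\<^sub>E i)"
          using y unfolding Ew is_inductive_def by blast
        then obtain z where z: "z \<in> M" "is_succ y z"
          using u by blast
        \<comment> \<open>Each inductive set provides some successor of \<open>y\<close>; by
          extensionality it is always the same \<open>z\<close>, which therefore lies in
          \<open>w\<close>.\<close>
        have "z' = z" if "z' \<in> M" "is_succ y z'" for z'
          using z that y by (simp add: is_succ_iff elts_inject[symmetric])
        then have "z \<in>\<^sub>E w"
          unfolding Ew using \<open>\<forall>i\<in>M. is_inductive i \<longrightarrow> (\<exists>z\<in>M. is_succ y z \<and> z \<in>\<^sub>E i)\<close> by metis
        moreover have "z \<noteq> x"
        \<comment> \<open>If \<open>x\<close> were the successor of \<open>y\<close>, then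
          \<open>y\<close> would be an element of \<open>x\<close>, hence a \<open>num n\<close> by
          induction, and \<open>x\<close> would be the next numeral.\<close>
        proof
          assume "z = x"
          then have "y \<in>\<^sub>E x"
            using z y by (simp add: is_succ_def)
          then obtain n where "y = num n"
            using step \<open>y \<in>\<^sub>E w\<close> by blast
          then show False
            using z x \<open>z = x\<close> by (auto simp: is_succ_num simp del: num.simps)
        qed
        ultimately show "\<exists>z\<in>M. is_succ y z \<and> z \<in>\<^sub>E v"
          using z Ev by blast
      qed
      then show False
        using x(1) v(1) Ev Ew by blast
    qed
  qed
  then have "elts w = range num"
    using is_inductive_num Ew by (auto simp: elts_eq_iff)
  then show ?thesis
    using w(1) by blast
qed

sublocale omega_model M E
  by unfold_locales (rule omega_in_model)

lemma power:
  assumes "a \<in> M"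
  obtains b where "b \<in> M" "\<And>x. x \<in> M \<Longrightarrow> elts x \<subseteq> elts a \<Longrightarrow> x \<in>\<^sub>E b"
proof -
  have power_ax
    using zfc by (simp add: models_ZFC_def)
  then show ?thesis
    using assms that unfolding power_ax_def by (metis subset_iff)
qed

text \<open>A Kuratowski pair lies in the second power set of the union. An upper bound is enough,
  as separation trims it afterwards.\<close>

lemma pairs_bound:
  assumes "a \<in> M" "b \<in> M"
  obtains c where "c \<in> M" "\<And>x y. x \<in>\<^sub>E a \<Longrightarrow> y \<in>\<^sub>E b \<Longrightarrow> opair x y \<in>\<^sub>E c"
proof -
  obtain u where u: "u \<in> M" "elts u = elts a \<union> elts b"
    using union[OF assms] by blast
  then have Eu: "z \<in>\<^sub>E u \<longleftrightarrow> z \<in>\<^sub>E a \<or> z \<in>\<^sub>E b" for z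
    by (simp add: elts_eq_iff)
  obtain v where v: "v \<in> M" "\<And>x. x \<in> M \<Longrightarrow> elts x \<subseteq> elts u \<Longrightarrow> x \<in>\<^sub>E v"
    using power[OF u(1)] by blast
  obtain c where c: "c \<in> M" "\<And>x. x \<in> M \<Longrightarrow> elts x \<subseteq> elts v \<Longrightarrow> x \<in>\<^sub>E c"
    using power[OF v(1)] by blast
  have "opair x y \<in>\<^sub>E c" if "x \<in>\<^sub>E a" "y \<in>\<^sub>E b" for x y
  proof (rule c(2))
    have M: "x \<in> M" "y \<in> M"
      using that assms E_in_M by blast+
    then show "opair x y \<in> M"
      by simp
    have "mk {x} \<in>\<^sub>E v" "mk {x, y} \<in>\<^sub>E v"
      using that M by (auto simp: Eu intro!: v(2))
    then show "elts (opair x y) \<subseteq> elts v"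
      using M unfolding opair_def by simp
  qed
  then show ?thesis
    using that c(1) by blast
qed

text \<open>Every node is a set of pairs of numbers, so all nodes lie in one power set, from which
  the formula \<open>node\<close> separates them.\<close>

lemma nodes_in_M:
  obtains P where "P \<in> M" "elts P = range enc"
proof -
  obtain c where c: "c \<in> M" "\<And>x y. x \<in>\<^sub>E omega \<Longrightarrow> y \<in>\<^sub>E omega \<Longrightarrow> opair x y \<in>\<^sub>E c"
    using pairs_bound[OF omega_in_M omega_in_M] by blast
  obtain b where b: "b \<in> M" "\<And>x. x \<in> M \<Longrightarrow> elts x \<subseteq> elts c \<Longrightarrow> x \<in>\<^sub>E b"
    using power[OF c(1)] by blast
  have "definable (\<lambda>\<rho>. node (\<rho> 0))"
    by (intro dfb)
  then obtain P where P: "P \<in> M" "elts P = {x. x \<in>\<^sub>E b \<and> node x}"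
    by (rule sep[where Q = "\<lambda>x _ _ _. node x", OF _ b(1) b(1) b(1) b(1)]) blast
  have "enc xs \<in>\<^sub>E b" for xs
    by (rule b(2)) (auto simp: E_enc E_omega intro!: c(2))
  then have "elts P = range enc"
    unfolding P(2) using node_iff b(1) by auto
  then show ?thesis
    using that P(1) by blast
qed

section \<open>Check names\<close>

text \<open>Phrased with \<open>is_opair\<close> and quantifiers over \<open>M\<close> to make
  definability automatic. That \<open>f\<close> is single-valued is not demanded; it follows from
  well-foundedness in \<open>attempt_unique\<close>.\<close>

definition attempt :: "'a \<Rightarrow> 'a \<Rightarrow> bool" where
  "attempt e f \<longleftrightarrow> (\<forall>z\<in>M. z \<in>\<^sub>E f \<longrightarrow> (\<exists>x\<in>M. \<exists>v\<in>M. is_opair x v z \<and>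
     (\<forall>y\<in>M. y \<in>\<^sub>E x \<longrightarrow> (\<exists>w\<in>M. \<exists>t\<in>M. \<exists>u\<in>M. is_opair y w t \<and> t \<in>\<^sub>E f \<and> is_opair w e u \<and> u \<in>\<^sub>E v)) \<and>
     (\<forall>u\<in>M. u \<in>\<^sub>E v \<longrightarrow> (\<exists>y\<in>M. \<exists>w\<in>M. \<exists>t\<in>M. y \<in>\<^sub>E x \<and> is_opair y w t \<and> t \<in>\<^sub>E f \<and> is_opair w e u))))"

text \<open>\<open>check e x v\<close> says that \<open>v\<close> is the name \<open>{(w, e) | w. \<exists>y. y \<in>\<^sub>E x \<and> check e y w}\<close>. The function
  \<open>f\<close> may be a proper part of the graph of the recursion, hence a finite \<open>f\<close> suffices when \<open>x\<close> is
  hereditarily finite.\<close>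

definition check :: "'a \<Rightarrow> 'a \<Rightarrow> 'a \<Rightarrow> bool" where
  "check e x v \<longleftrightarrow> (\<exists>f\<in>M. \<exists>z\<in>M. attempt e f \<and> is_opair x v z \<and> z \<in>\<^sub>E f)"

lemma definable_attempt [dfb]: "definable (\<lambda>\<rho>. attempt (\<rho> i) (\<rho> j))"
  unfolding attempt_def by (intro dfb)

lemma definable_check [dfb]: "definable (\<lambda>\<rho>. check (\<rho> i) (\<rho> j) (\<rho> k))"
  unfolding check_def by (intro dfb)

lemma check_iff:
  "x \<in> M \<Longrightarrow> v \<in> M \<Longrightarrow> check e x v \<longleftrightarrow> (\<exists>f\<in>M. attempt e f \<and> opair x v \<in>\<^sub>E f)"
  unfolding check_def by (auto simp: is_opair_iff)

lemma attemptI: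
  assumes "e \<in> M" "f \<in> M"
    and "\<And>z. z \<in>\<^sub>E f \<Longrightarrow> \<exists>x\<in>M. \<exists>v\<in>M. z = opair x v \<and>
      (\<forall>y. y \<in>\<^sub>E x \<longrightarrow> (\<exists>w\<in>M. opair y w \<in>\<^sub>E f \<and> opair w e \<in>\<^sub>E v)) \<and>
      (\<forall>u. u \<in>\<^sub>E v \<longrightarrow> (\<exists>y w. y \<in>\<^sub>E x \<and> w \<in> M \<and> opair y w \<in>\<^sub>E f \<and> u = opair w e))"
  shows "attempt e f"
  unfolding attempt_def
proof (intro ballI impI)
  fix z assume "z \<in>\<^sub>E f"
  then obtain x v where xv: "x \<in> M" "v \<in> M" "z = opair x v"
    and 1: "\<forall>y. y \<in>\<^sub>E x \<longrightarrow> (\<exists>w\<in>M. opair y w \<in>\<^sub>E f \<and> opair w e \<in>\<^sub>E v)"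
    and 2: "\<forall>u. u \<in>\<^sub>E v \<longrightarrow> (\<exists>y w. y \<in>\<^sub>E x \<and> w \<in> M \<and> opair y w \<in>\<^sub>E f \<and> u = opair w e)"
    by (elim assms(3)[elim_format] bexE conjE)
  have "\<exists>w\<in>M. \<exists>t\<in>M. \<exists>u\<in>M. is_opair y w t \<and> t \<in>\<^sub>E f \<and> is_opair w e u \<and> u \<in>\<^sub>E v"
    if y: "y \<in> M" "y \<in>\<^sub>E x" for y
  proof -
    obtain w where "w \<in> M" "opair y w \<in>\<^sub>E f" "opair w e \<in>\<^sub>E v"
      using 1 y(2) by blast
    then show ?thesis
      using y(1) assms(1)
      by (intro bexI[of _ w] bexI[of _ "opair y w"] bexI[of _ "opair w e"])
        (simp_all add: is_opair_iff)
  qed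
  moreover have "\<exists>y\<in>M. \<exists>w\<in>M. \<exists>t\<in>M. y \<in>\<^sub>E x \<and> is_opair y w t \<and> t \<in>\<^sub>E f \<and> is_opair w e u"
    if u: "u \<in> M" "u \<in>\<^sub>E v" for u
  proof -
    obtain y w where y: "y \<in>\<^sub>E x" "w \<in> M" "opair y w \<in>\<^sub>E f" "u = opair w e"
      using 2 u(2) by blast
    then have "y \<in> M"
      using xv(1) E_in_M by blast
    then show ?thesis
      using y assms(1)
      by (intro bexI[of _ y] bexI[of _ w] bexI[of _ "opair y w"]) (simp_all add: is_opair_iff)
  qed
  moreover have "is_opair x v z"
    using xv by (simp add: is_opair_iff)
  ultimately show "\<exists>x\<in>M. \<exists>v\<in>M. is_opair x v z \<and>
     (\<forall>y\<in>M. y \<in>\<^sub>E x \<longrightarrow> (\<exists>w\<in>M. \<exists>t\<in>M. \<exists>u\<in>M. is_opair y w t \<and> t \<in>\<^sub>E f \<and> is_opair w e u \<and> u \<in>\<^sub>E v)) \<and>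
     (\<forall>u\<in>M. u \<in>\<^sub>E v \<longrightarrow> (\<exists>y\<in>M. \<exists>w\<in>M. \<exists>t\<in>M. y \<in>\<^sub>E x \<and> is_opair y w t \<and> t \<in>\<^sub>E f \<and> is_opair w e u))"
    using xv(1,2) by blast
qed

lemma attemptD:
  assumes "attempt e f" "e \<in> M" "f \<in> M" "opair x v \<in>\<^sub>E f" "x \<in> M" "v \<in> M"
  shows "y \<in>\<^sub>E x \<Longrightarrow> \<exists>w\<in>M. opair y w \<in>\<^sub>E f \<and> opair w e \<in>\<^sub>E v"
    and "u \<in>\<^sub>E v \<Longrightarrow> \<exists>y w. y \<in>\<^sub>E x \<and> w \<in> M \<and> opair y w \<in>\<^sub>E f \<and> u = opair w e"
proof -
  obtain x' v' where xv: "x' \<in> M" "v' \<in> M" "is_opair x' v' (opair x v)"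
    and 1: "\<forall>y\<in>M. y \<in>\<^sub>E x' \<longrightarrow>
      (\<exists>w\<in>M. \<exists>t\<in>M. \<exists>u\<in>M. is_opair y w t \<and> t \<in>\<^sub>E f \<and> is_opair w e u \<and> u \<in>\<^sub>E v')"
    and 2: "\<forall>u\<in>M. u \<in>\<^sub>E v' \<longrightarrow>
      (\<exists>y\<in>M. \<exists>w\<in>M. \<exists>t\<in>M. y \<in>\<^sub>E x' \<and> is_opair y w t \<and> t \<in>\<^sub>E f \<and> is_opair w e u)"
    using bspec[OF assms(1)[unfolded attempt_def] opair_in_M[OF assms(5,6)], THEN mp, OF assms(4)]
    by (elim bexE conjE)
  have [simp]: "x' = x" "v' = v"
    using xv assms by (simp_all add: is_opair_iff)
  show "\<exists>w\<in>M. opair y w \<in>\<^sub>E f \<and> opair w e \<in>\<^sub>E v" if "y \<in>\<^sub>E x"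
    using bspec[OF 1, of y] that E_in_M[OF that] assms by (auto simp: is_opair_iff)
  show "\<exists>y w. y \<in>\<^sub>E x \<and> w \<in> M \<and> opair y w \<in>\<^sub>E f \<and> u = opair w e" if "u \<in>\<^sub>E v"
    using bspec[OF 2, of u] that E_in_M[OF that] assms by (auto simp: is_opair_iff)
qed

text \<open>By induction on \<open>x\<close>, the names that \<open>f\<close> and \<open>f'\<close>
  assign to the elements of \<open>x\<close> agree, and these determine the name of
  \<open>x\<close>. Two attempts are compared because \<open>check\<close> may use a different one
  for each value.\<close>

lemma attempt_unique:
  assumes "e \<in> M" "f \<in> M" "f' \<in> M" "attempt e f" "attempt e f'"
  shows "opair x v \<in>\<^sub>E f \<Longrightarrow> opair x v' \<in>\<^sub>E f' \<Longrightarrow> x \<in> M \<Longrightarrow> v \<in> M \<Longrightarrow> v' \<in> M \<Longrightarrow> v = v'"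
proof (induction x arbitrary: v v' rule: E_induct)
  case (step x)
  \<comment> \<open>One inclusion, stated for arbitrary attempts so that it can be used in both
    directions.\<close>
  have sub: "u \<in>\<^sub>E v2"
    if f: "f1 \<in> M" "f2 \<in> M" "attempt e f1" "attempt e f2"
      and xv: "opair x v1 \<in>\<^sub>E f1" "opair x v2 \<in>\<^sub>E f2" "v1 \<in> M" "v2 \<in> M"
      and IH: "\<And>y w w'. y \<in>\<^sub>E x \<Longrightarrow> opair y w \<in>\<^sub>E f1 \<Longrightarrow> opair y w' \<in>\<^sub>E f2 \<Longrightarrow>
        w \<in> M \<Longrightarrow> w' \<in> M \<Longrightarrow> w = w'"
      and u: "u \<in>\<^sub>E v1" for f1 f2 v1 v2 u
  proof -
    obtain y w where y: "y \<in>\<^sub>E x" "w \<in> M" "opair y w \<in>\<^sub>E f1" "u = opair w e"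
      using attemptD(2)[OF f(3) assms(1) f(1) xv(1) step.prems(3) xv(3) u] by blast
    obtain w' where "w' \<in> M" "opair y w' \<in>\<^sub>E f2" "opair w' e \<in>\<^sub>E v2"
      using attemptD(1)[OF f(4) assms(1) f(2) xv(2) step.prems(3) xv(4) y(1)] by blast
    then show ?thesis
      using IH[OF y(1,3)] y(2,4) by blast
  qed
  have IH: "w = w'" if "y \<in>\<^sub>E x" "opair y w \<in>\<^sub>E f" "opair y w' \<in>\<^sub>E f'" "w \<in> M" "w' \<in> M" for y w w'
    using step.IH[OF that(1,2,3) E_in_M[OF that(1) step.prems(3)] that(4,5)] .
  show ?case
  proof (rule ext, rule iffI)
    fix u
    show "u \<in>\<^sub>E v \<Longrightarrow> u \<in>\<^sub>E v'"
      by (rule sub[of f f' v v']) (use assms step.prems IH in auto)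
    show "u \<in>\<^sub>E v' \<Longrightarrow> u \<in>\<^sub>E v"
      by (rule sub[of f' f v' v]) (use assms step.prems IH[symmetric] in auto)
  qed
qed

lemma check_unique:
  assumes "check e x v" "check e x v'" "e \<in> M" "x \<in> M" "v \<in> M" "v' \<in> M"
  shows "v = v'"
  using assms attempt_unique[OF assms(3)] by (auto simp: check_iff)

text \<open>Attempts for the finitely many elements of \<open>x\<close> are united and one pair is
  added. The result stays finite and thus belongs to \<open>M\<close>, which replaces a general
  recursion theorem.\<close>

lemma check_exists:
  assumes "hf x" "x \<in> M" "e \<in> M"
  shows "\<exists>v\<in>M. check e x v"
proof -
  have "\<exists>f\<in>M. \<exists>v\<in>M. finite (elts f) \<and> attempt e f \<and> opair x v \<in>\<^sub>E f"
    using assms(1,2)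
  proof induction
    case (1 x)
    then have "\<exists>f v. f \<in> M \<and> v \<in> M \<and> finite (elts f) \<and> attempt e f \<and> opair y v \<in>\<^sub>E f"
      if "y \<in>\<^sub>E x" for y
      using that by blast
    then obtain f v where fv: "\<And>y. y \<in>\<^sub>E x \<Longrightarrow> f y \<in> M \<and> v y \<in> M \<and> finite (elts (f y)) \<and>
        attempt e (f y) \<and> opair y (v y) \<in>\<^sub>E f y"
      by metis
    define V where "V = mk ((\<lambda>y. opair (v y) e) ` elts x)"
    define A where "A = insert (opair x V) (\<Union>y\<in>elts x. elts (f y))"
    have V: "V \<in> M" "u \<in>\<^sub>E V \<longleftrightarrow> (\<exists>y. y \<in>\<^sub>E x \<and> u = opair (v y) e)" for u
    proof -
      have *: "finite ((\<lambda>y. opair (v y) e) ` elts x)" "(\<lambda>y. opair (v y) e) ` elts x \<subseteq> M"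
        using "1.hyps" fv assms(3) by auto
      show "V \<in> M" "u \<in>\<^sub>E V \<longleftrightarrow> (\<exists>y. y \<in>\<^sub>E x \<and> u = opair (v y) e)"
        using * by (auto simp: V_def)
    qed
    have fin: "finite A"
      using "1.hyps" fv by (auto simp: A_def)
    have "z \<in> M" if "y \<in>\<^sub>E x" "z \<in>\<^sub>E f y" for y z
      using fv that E_in_M by blast
    then have AM: "A \<subseteq> M"
      using V(1) "1.prems" by (auto simp: A_def)
    define F where "F = mk A"
    have F: "F \<in> M" "elts F = A" "\<And>z. z \<in>\<^sub>E F \<longleftrightarrow> z \<in> A"
      using fin AM by (simp_all add: F_def)
    have fF: "z \<in>\<^sub>E F" if "y \<in>\<^sub>E x" "z \<in>\<^sub>E f y" for y z
      using that unfolding F A_def by auto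
    have "attempt e F"
    proof (rule attemptI[OF assms(3) F(1)])
      fix z assume "z \<in>\<^sub>E F"
      then consider "z = opair x V" | y where "y \<in>\<^sub>E x" "z \<in>\<^sub>E f y"
        unfolding F A_def by auto
      then show "\<exists>x\<in>M. \<exists>v\<in>M. z = opair x v \<and>
        (\<forall>y. y \<in>\<^sub>E x \<longrightarrow> (\<exists>w\<in>M. opair y w \<in>\<^sub>E F \<and> opair w e \<in>\<^sub>E v)) \<and>
        (\<forall>u. u \<in>\<^sub>E v \<longrightarrow> (\<exists>y w. y \<in>\<^sub>E x \<and> w \<in> M \<and> opair y w \<in>\<^sub>E F \<and> u = opair w e))"
      proof cases
        case 1
        have "\<exists>w\<in>M. opair y w \<in>\<^sub>E F \<and> opair w e \<in>\<^sub>E V" if "y \<in>\<^sub>E x" for y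
          using that fv[OF that] fF[OF that] V(2) by blast
        moreover have "\<exists>y w. y \<in>\<^sub>E x \<and> w \<in> M \<and> opair y w \<in>\<^sub>E F \<and> u = opair w e"
          if "u \<in>\<^sub>E V" for u
          using that fv fF V(2) by meson
        ultimately show ?thesis
          using 1 \<open>x \<in> M\<close> V(1) by blast
      next
        \<comment> \<open>An old pair stays correct: the conditions on it only ask that certain
          pairs be present, and \<open>F\<close> contains all of \<open>f y\<close>.\<close>
        case (2 y)
        have fy: "attempt e (f y)" "f y \<in> M"
          using fv[OF 2(1)] by auto
        obtain a b where ab: "a \<in> M" "b \<in> M" "z = opair a b"
          using fy 2(2) unfolding attempt_def by (metis E_in_M is_opair_iff)
        note D = attemptD[OF fy(1) assms(3) fy(2) 2(2)[unfolded ab(3)] ab(1,2)]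
        have "\<forall>y. y \<in>\<^sub>E a \<longrightarrow> (\<exists>w\<in>M. opair y w \<in>\<^sub>E F \<and> opair w e \<in>\<^sub>E b)"
          using D(1) fF[OF 2(1)] by blast
        moreover have "\<forall>u. u \<in>\<^sub>E b \<longrightarrow> (\<exists>y w. y \<in>\<^sub>E a \<and> w \<in> M \<and> opair y w \<in>\<^sub>E F \<and> u = opair w e)"
          using D(2) fF[OF 2(1)] by blast
        ultimately show ?thesis
          using ab by (intro bexI[of _ a] bexI[of _ b] conjI)
      qed
    qed
    moreover have "opair x V \<in>\<^sub>E F"
      by (simp add: F(3) A_def)
    ultimately show ?case
      using F(1,2) V(1) fin by blast
  qed
  then show ?thesis
    using assms(2) by (metis check_iff)
qed

end

section \<open>The generic extension\<close>

locale seq_extension = zfc_model M E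
  for M :: "'a set" and E :: "'a \<Rightarrow> 'a \<Rightarrow> bool"  (infix "\<in>\<^sub>E" 50) +
  fixes G N :: "'a set"
  assumes generic: "generic_filter seq_poset seq_le G"
    and extension: "is_generic_extension seq_poset G N"
begin

section \<open>The generic filter as a set of lists\<close>

lemma seq_poset_eq: "seq_poset = range enc"
  unfolding seq_poset_def using node_iff by auto

lemma G_enc: "p \<in> G \<Longrightarrow> p \<in> range enc"
  using generic unfolding generic_filter_def seq_poset_eq by blast

lemma G_in_M: "p \<in> G \<Longrightarrow> p \<in> M"
  using G_enc enc_in_M by blast

lemma G_prefix: "enc ys \<in> G \<Longrightarrow> prefix xs ys \<Longrightarrow> enc xs \<in> G"
  using generic subset_enc_iff unfolding generic_filter_def seq_poset_eq seq_le_def by blast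

lemma G_Nil: "enc [] \<in> G"
proof -
  have "G \<noteq> {}"
    using generic unfolding generic_filter_def by blast
  then obtain ys where "enc ys \<in> G"
    using G_enc by blast
  then show ?thesis
    using G_prefix by auto
qed

text \<open>Two members of a filter have a common extension, and initial segments of one sequence
  are comparable.\<close>

lemma G_comparable:
  assumes "enc xs \<in> G" "enc ys \<in> G"
  shows "prefix xs ys \<or> prefix ys xs"
proof -
  obtain r where "r \<in> G" "seq_le r (enc xs)" "seq_le r (enc ys)"
    using generic assms unfolding generic_filter_def by blast
  then obtain zs where "prefix xs zs" "prefix ys zs"
    using G_enc subset_enc_iff unfolding seq_le_def by blast
  then show ?thesis
    using prefix_same_cases by blast
qed

lemma G_dense:
  assumes "D \<in> M" "elts D \<subseteq> range enc" "\<And>xs. \<exists>ys. prefix xs ys \<and> enc ys \<in>\<^sub>E D"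
  obtains xs where "enc xs \<in> G" "enc xs \<in>\<^sub>E D"
proof -
  have "dense_in seq_poset seq_le D"
    unfolding dense_in_def seq_poset_eq seq_le_def
  proof (intro conjI ballI impI)
    fix p assume "p \<in> range enc"
    then obtain xs where xs: "p = enc xs"
      by blast
    obtain ys where "prefix xs ys" "enc ys \<in>\<^sub>E D"
      using assms(3) by blast
    then show "\<exists>d\<in>M. d \<in>\<^sub>E D \<and> subset p d"
      unfolding xs using subset_enc_iff enc_in_M by blast
  qed (use assms in auto)
  then obtain p where "p \<in> G" "p \<in>\<^sub>E D"
    using generic assms(1) unfolding generic_filter_def by blast
  then show ?thesis
    using that G_enc by blast
qed

section \<open>Names and their values\<close>

abbreviation "name \<equiv> is_name seq_poset"
abbreviation "value_of \<equiv> is_value G"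

lemma name_in_M: "name \<tau> \<Longrightarrow> \<tau> \<in> M"
  by (auto elim: is_name.cases)

lemma nameI:
  assumes "\<tau> \<in> M"
    and "\<And>z. z \<in>\<^sub>E \<tau> \<Longrightarrow> \<exists>\<sigma> xs. name \<sigma> \<and> z = opair \<sigma> (enc xs)"
  shows "name \<tau>"
proof (rule is_name.intros[OF assms(1)], intro ballI impI)
  fix z assume z: "z \<in> M" "z \<in>\<^sub>E \<tau>"
  then obtain \<sigma> xs where "name \<sigma>" "z = opair \<sigma> (enc xs)"
    using assms(2) by blast
  moreover from this have "is_opair \<sigma> (enc xs) z"
    using z name_in_M by (simp add: is_opair_iff)
  ultimately show "\<exists>\<sigma>. \<exists>p\<in>seq_poset. is_opair \<sigma> p z \<and> name \<sigma>"
    unfolding seq_poset_eq by blast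
qed

lemma name_of_opair:
  assumes "name \<tau>" "opair \<sigma> p \<in>\<^sub>E \<tau>" "\<sigma> \<in> M" "p \<in> M"
  shows "name \<sigma>"
  using assms(1)
proof cases
  case 1
  then obtain \<sigma>' p' where "p' \<in> seq_poset" "is_opair \<sigma>' p' (opair \<sigma> p)" "name \<sigma>'"
    using assms opair_in_M by blast
  then have "\<sigma> = \<sigma>'"
    using assms name_in_M unfolding seq_poset_eq by (auto simp: is_opair_iff)
  then show ?thesis
    using \<open>name \<sigma>'\<close> by simp
qed

text \<open>Induction on the derivation of the first value: elements of both values arise from the
  same pairs of \<open>\<tau>\<close>, and extensionality of \<open>E\<close> concludes.\<close>

lemma value_unique: "value_of \<tau> x \<Longrightarrow> value_of \<tau> y \<Longrightarrow> x = y"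
proof (induction arbitrary: y rule: is_value.induct)
  case (1 \<tau> x)
  from \<open>value_of \<tau> y\<close> show ?case
  proof cases
    case y: 1
    show ?thesis
    proof (rule ext, rule iffI)
      fix z assume "z \<in>\<^sub>E x"
      then obtain u \<sigma> p where u: "u \<in> M" "\<sigma> \<in> M" "p \<in> G" "u \<in>\<^sub>E \<tau>" "is_opair \<sigma> p u"
        and IH: "\<And>z'. value_of \<sigma> z' \<Longrightarrow> z = z'"
        using "1.IH"(2) by blast
      then obtain z' where "z' \<in>\<^sub>E y" "value_of \<sigma> z'"
        using y(1) by blast
      then show "z \<in>\<^sub>E y"
        using IH by blast
    next
      fix z assume "z \<in>\<^sub>E y"
      then obtain u \<sigma> p where u: "u \<in> M" "\<sigma> \<in> M" "p \<in> G" "u \<in>\<^sub>E \<tau>" "is_opair \<sigma> p u"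
        and z: "value_of \<sigma> z"
        using y(2) by blast
      then obtain z' where "z' \<in>\<^sub>E x" "\<And>z''. value_of \<sigma> z'' \<Longrightarrow> z' = z''"
        using "1.IH"(1) by blast
      then show "z \<in>\<^sub>E x"
        using z by blast
    qed
  qed
qed

lemma valueI:
  assumes "\<And>\<sigma> p. \<sigma> \<in> M \<Longrightarrow> p \<in> G \<Longrightarrow> opair \<sigma> p \<in>\<^sub>E \<tau> \<Longrightarrow> \<exists>y. y \<in>\<^sub>E x \<and> value_of \<sigma> y"
    and "\<And>y. y \<in>\<^sub>E x \<Longrightarrow> \<exists>\<sigma>\<in>M. \<exists>p\<in>G. opair \<sigma> p \<in>\<^sub>E \<tau> \<and> value_of \<sigma> y"
  shows "value_of \<tau> x"
proof (rule is_value.intros)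
  show "\<forall>z\<in>M. \<forall>\<sigma>\<in>M. \<forall>p\<in>G. z \<in>\<^sub>E \<tau> \<and> is_opair \<sigma> p z \<longrightarrow> (\<exists>y. y \<in>\<^sub>E x \<and> value_of \<sigma> y)"
    using assms(1) G_in_M by (auto simp: is_opair_iff)
  show "\<forall>y. y \<in>\<^sub>E x \<longrightarrow> (\<exists>z\<in>M. \<exists>\<sigma>\<in>M. \<exists>p\<in>G. z \<in>\<^sub>E \<tau> \<and> is_opair \<sigma> p z \<and> value_of \<sigma> y)"
    using assms(2) G_in_M by (meson is_opair_iff opair_in_M)
qed

lemma E_value_iff:
  assumes "value_of \<tau> x"
  shows "y \<in>\<^sub>E x \<longleftrightarrow> (\<exists>\<sigma>\<in>M. \<exists>p\<in>G. opair \<sigma> p \<in>\<^sub>E \<tau> \<and> value_of \<sigma> y)"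
  using assms
proof cases
  case 1
  show ?thesis
  proof
    assume "y \<in>\<^sub>E x"
    then obtain z \<sigma> p where "z \<in> M" "\<sigma> \<in> M" "p \<in> G" "z \<in>\<^sub>E \<tau>" "is_opair \<sigma> p z" "value_of \<sigma> y"
      using 1(2) by blast
    then show "\<exists>\<sigma>\<in>M. \<exists>p\<in>G. opair \<sigma> p \<in>\<^sub>E \<tau> \<and> value_of \<sigma> y"
      using G_in_M is_opair_iff by blast
  next
    assume "\<exists>\<sigma>\<in>M. \<exists>p\<in>G. opair \<sigma> p \<in>\<^sub>E \<tau> \<and> value_of \<sigma> y"
    then obtain \<sigma> p where *: "\<sigma> \<in> M" "p \<in> G" "opair \<sigma> p \<in>\<^sub>E \<tau>" "value_of \<sigma> y"
      by blast
    then have "opair \<sigma> p \<in> M" "is_opair \<sigma> p (opair \<sigma> p)"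
      using G_in_M by (simp_all add: is_opair_iff)
    then obtain y' where "y' \<in>\<^sub>E x" "value_of \<sigma> y'"
      using 1(1) * by blast
    then show "y \<in>\<^sub>E x"
      using *(4) value_unique by blast
  qed
qed

text \<open>\<open>is_generic_extension\<close> puts only some value of each name into
  \<open>N\<close>; by \<open>value_unique\<close> there is no other.\<close>

lemma N_iff: "x \<in> N \<longleftrightarrow> (\<exists>\<tau>. name \<tau> \<and> value_of \<tau> x)"
  using extension value_unique unfolding is_generic_extension_def by blast

lemma name_value: "name \<tau> \<Longrightarrow> \<exists>x\<in>N. value_of \<tau> x"
  using extension unfolding is_generic_extension_def by blast

text \<open>All conditions in a check name are \<open>enc []\<close>, the weakest one, which lies in
  \<open>G\<close>. So no element is lost in the evaluation.\<close>

lemma check_name: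
  assumes "check (enc []) x v" "x \<in> M" "v \<in> M"
  shows "name v \<and> value_of v x"
proof -
  obtain f where f: "f \<in> M" "attempt (enc []) f" "opair x v \<in>\<^sub>E f"
    using assms by (auto simp: check_iff)
  show ?thesis
    using assms(2,3) f(3)
  proof (induction x arbitrary: v rule: E_induct)
    case (step x)
    note D = attemptD[OF f(2) enc_in_M f(1) step.prems(3,1,2)]
    have IH: "name w" "value_of w y" if "y \<in>\<^sub>E x" "w \<in> M" "opair y w \<in>\<^sub>E f" for y w
      using step.IH[OF that(1) _ that(2,3)] that(1) step.prems(1) by auto
    have "name v"
      by (rule nameI[OF step.prems(2)]) (use D(2) IH(1) in blast)
    moreover have "value_of v x"
    proof (rule valueI)
      fix \<sigma> p assume *: "\<sigma> \<in> M" "p \<in> G" "opair \<sigma> p \<in>\<^sub>E v"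
      then obtain y w where "y \<in>\<^sub>E x" "w \<in> M" "opair y w \<in>\<^sub>E f" "opair \<sigma> p = opair w (enc [])"
        using D(2) by blast
      then show "\<exists>y. y \<in>\<^sub>E x \<and> value_of \<sigma> y"
        using IH(2) * G_in_M by auto
    next
      fix y assume "y \<in>\<^sub>E x"
      then show "\<exists>\<sigma>\<in>M. \<exists>p\<in>G. opair \<sigma> p \<in>\<^sub>E v \<and> value_of \<sigma> y"
        using D(1) IH(2) G_Nil by blast
    qed
    ultimately show ?case ..
  qed
qed

text \<open>The required set is named by all pairs of a check name of \<open>s\<close> and a
  condition \<open>p\<close> with \<open>R s p\<close>. Membership can be read off from
  \<open>G\<close> directly, without a truth lemma.\<close>

lemma definable_in_N:
  assumes a: "a \<in> M" "\<And>s. s \<in>\<^sub>E a \<Longrightarrow> hf s"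
    and R: "\<And>i j. definable (\<lambda>\<rho>. R (\<rho> i) (\<rho> j))"
  shows "\<exists>x\<in>N. elts x = {s. s \<in>\<^sub>E a \<and> (\<exists>p\<in>G. R s p)}"
proof -
  let ?e = "enc []"
  have ex: "\<exists>!v. v \<in> M \<and> check ?e s v" if "s \<in> M" "s \<in>\<^sub>E a" for s
    using check_exists[OF a(2)[OF that(2)] that(1) enc_in_M] check_unique that(1) enc_in_M by metis
  have rep: replacement_ax
    using zfc by (simp add: models_ZFC_def)
  have def: "definable (\<lambda>\<rho>. check (\<rho> 2) (\<rho> 0) (\<rho> 1))"
    by (intro dfb)
  \<comment> \<open>Replacement collects the check names into a set \<open>B\<close>, so that the
    pairs needed are bounded by a set \<open>c\<close> of \<open>M\<close> and \<open>\<tau>\<close>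
    can be separated from it.\<close>
  have "\<exists>B\<in>M. \<forall>v\<in>M. v \<in>\<^sub>E B \<longleftrightarrow> (\<exists>s\<in>M. s \<in>\<^sub>E a \<and> check ?e s v)"
  proof (rule replacement[where Q = "\<lambda>s v e. check e s v", OF rep def a(1) enc_in_M ex])
    fix b assume "b \<in> M" "\<And>v. v \<in> M \<Longrightarrow> v \<in>\<^sub>E b \<longleftrightarrow> (\<exists>s\<in>M. s \<in>\<^sub>E a \<and> check ?e s v)"
    then show ?thesis
      by (intro bexI[of _ b] ballI)
  qed
  then obtain B where B: "B \<in> M" "\<forall>v\<in>M. v \<in>\<^sub>E B \<longleftrightarrow> (\<exists>s\<in>M. s \<in>\<^sub>E a \<and> check ?e s v)"
    by (elim bexE)
  obtain P where P: "P \<in> M" "elts P = range enc"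
    using nodes_in_M by blast
  then have EP: "p \<in>\<^sub>E P \<longleftrightarrow> p \<in> range enc" for p
    by (simp add: elts_eq_iff)
  obtain c where c: "c \<in> M" "\<And>v p. v \<in>\<^sub>E B \<Longrightarrow> p \<in>\<^sub>E P \<Longrightarrow> opair v p \<in>\<^sub>E c"
    using pairs_bound[OF B(1) P(1)] by blast
  define Q where "Q u a P e \<longleftrightarrow> (\<exists>s\<in>M. \<exists>p\<in>M. \<exists>v\<in>M. s \<in>\<^sub>E a \<and> p \<in>\<^sub>E P \<and> check e s v \<and>
    R s p \<and> is_opair v p u)" for u a P e
  have "definable (\<lambda>\<rho>. Q (\<rho> 0) (\<rho> 1) (\<rho> 2) (\<rho> 3))"
    unfolding Q_def by (intro dfb R)
  then obtain \<tau> where \<tau>: "\<tau> \<in> M" "elts \<tau> = {u. u \<in>\<^sub>E c \<and> Q u a P ?e}"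
    using sep[where Q = Q, OF _ c(1) a(1) P(1) enc_in_M] by blast
  have E\<tau>: "u \<in>\<^sub>E \<tau> \<longleftrightarrow> (\<exists>s v xs. v \<in> M \<and> s \<in>\<^sub>E a \<and> check ?e s v \<and> R s (enc xs) \<and> u = opair v (enc xs))"
    (is "_ \<longleftrightarrow> ?R") for u
  proof
    assume "u \<in>\<^sub>E \<tau>"
    then obtain s p v where *: "s \<in> M" "p \<in> M" "v \<in> M" "s \<in>\<^sub>E a" "p \<in>\<^sub>E P" "check ?e s v"
        "R s p" "is_opair v p u" "u \<in>\<^sub>E c"
      using \<tau>(2) unfolding elts_eq_iff Q_def by blast
    then have "u \<in> M" using c(1) by blast
    then show ?R
      using * unfolding EP by (auto simp: is_opair_iff)
  next
    assume ?R
    then obtain s v xs where *: "v \<in> M" "s \<in>\<^sub>E a" "check ?e s v" "R s (enc xs)" "u = opair v (enc xs)"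
      by blast
    then have sM: "s \<in> M"
      using a(1) by blast
    then have "v \<in>\<^sub>E B"
      using * B(2) by blast
    then have "u \<in>\<^sub>E c"
      using * c(2) EP by blast
    moreover have "enc xs \<in>\<^sub>E P" "is_opair v (enc xs) u"
      using * EP by (simp_all add: is_opair_iff)
    then have "Q u a P ?e"
      using * sM enc_in_M unfolding Q_def by blast
    ultimately show "u \<in>\<^sub>E \<tau>"
      using \<tau>(2) unfolding elts_eq_iff by blast
  qed
  have chk: "name v \<and> value_of v s" if "check ?e s v" "s \<in>\<^sub>E a" "v \<in> M" for s v
    using check_name[OF that(1) _ that(3)] a(1) that(2) by blast
  have "name \<tau>"
    by (rule nameI[OF \<tau>(1)]) (use chk E\<tau> in blast)
  then obtain x where x: "x \<in> N" "value_of \<tau> x"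
    using name_value by blast
  have "y \<in>\<^sub>E x \<longleftrightarrow> y \<in>\<^sub>E a \<and> (\<exists>p\<in>G. R y p)" for y
  proof
    assume "y \<in>\<^sub>E x"
    then obtain \<sigma> p where *: "\<sigma> \<in> M" "p \<in> G" "opair \<sigma> p \<in>\<^sub>E \<tau>" "value_of \<sigma> y"
      using E_value_iff[OF x(2)] by blast
    then obtain s v xs where s: "v \<in> M" "s \<in>\<^sub>E a" "check ?e s v" "R s (enc xs)"
        "opair \<sigma> p = opair v (enc xs)"
      unfolding E\<tau> by blast
    then have "\<sigma> = v" "p = enc xs"
      using * G_in_M by auto
    moreover have "y = s"
      using chk[OF s(3,2,1)] *(4) \<open>\<sigma> = v\<close> value_unique by blast
    ultimately show "y \<in>\<^sub>E a \<and> (\<exists>p\<in>G. R y p)"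
      using s * by blast
  next
    assume *: "y \<in>\<^sub>E a \<and> (\<exists>p\<in>G. R y p)"
    then obtain xs where xs: "enc xs \<in> G" "R y (enc xs)"
      using G_enc by blast
    obtain v where v: "v \<in> M" "check ?e y v"
      using ex[of y] * a(1) by blast
    then have "opair v (enc xs) \<in>\<^sub>E \<tau>"
      unfolding E\<tau> using * xs by blast
    then show "y \<in>\<^sub>E x"
      using E_value_iff[OF x(2)] chk[OF v(2) _ v(1)] * v xs by blast
  qed
  then show ?thesis
    using x(1) by (auto simp: elts_eq_iff)
qed

lemma extension_omega_model: "omega_model N E"
proof
  show "set_structure.transitive N E"
    unfolding set_structure.transitive_def
  proof (intro ballI allI impI)
    fix x y assume "x \<in> N" "y \<in>\<^sub>E x"
    then obtain \<tau> where \<tau>: "name \<tau>" "value_of \<tau> x"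
      unfolding N_iff by blast
    then obtain \<sigma> p where "\<sigma> \<in> M" "p \<in> G" "opair \<sigma> p \<in>\<^sub>E \<tau>" "value_of \<sigma> y"
      using \<open>y \<in>\<^sub>E x\<close> E_value_iff by blast
    then show "y \<in> N"
      using name_of_opair[OF \<tau>(1)] G_in_M unfolding N_iff by blast
  qed
next
  fix A assume A: "finite A" "A \<subseteq> N"
  then have "\<forall>x\<in>A. \<exists>\<tau>. name \<tau> \<and> value_of \<tau> x"
    using N_iff by blast
  then obtain t where t: "\<And>x. x \<in> A \<Longrightarrow> name (t x)" "\<And>x. x \<in> A \<Longrightarrow> value_of (t x) x"
    by metis
  \<comment> \<open>Names of the finitely many elements, each paired with the weakest
    condition.\<close>
  define \<tau> where "\<tau> = mk ((\<lambda>x. opair (t x) (enc [])) ` A)"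
  have sub: "(\<lambda>x. opair (t x) (enc [])) ` A \<subseteq> M"
    using t(1) name_in_M by auto
  then have \<tau>: "\<tau> \<in> M" "\<And>z. z \<in>\<^sub>E \<tau> \<longleftrightarrow> (\<exists>x\<in>A. z = opair (t x) (enc []))"
    using A(1) by (auto simp: \<tau>_def)
  have "name \<tau>"
    by (rule nameI[OF \<tau>(1)]) (use \<tau>(2) t(1) in blast)
  then obtain x where x: "x \<in> N" "value_of \<tau> x"
    using name_value by blast
  have "y \<in>\<^sub>E x \<longleftrightarrow> y \<in> A" for y
  proof
    assume "y \<in>\<^sub>E x"
    then obtain \<sigma> p where *: "\<sigma> \<in> M" "p \<in> G" "opair \<sigma> p \<in>\<^sub>E \<tau>" "value_of \<sigma> y"
      using E_value_iff[OF x(2)] by blast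
    then obtain a where "a \<in> A" "opair \<sigma> p = opair (t a) (enc [])"
      using \<tau>(2) by blast
    then show "y \<in> A"
      using * t value_unique G_in_M name_in_M by (metis enc_in_M opair_inject)
  next
    assume "y \<in> A"
    then show "y \<in>\<^sub>E x"
      using E_value_iff[OF x(2)] \<tau>(2) t name_in_M G_Nil by blast
  qed
  then show "\<exists>x\<in>N. elts x = A"
    using x(1) by (auto simp: elts_eq_iff)
next
  \<comment> \<open>With a relation that always holds, \<open>definable_in_N\<close> returns
    \<open>omega\<close> itself, since \<open>G\<close> is nonempty.\<close>
  have "definable (\<lambda>\<rho>. \<rho> i = \<rho> i)" for i
    by (intro dfb)
  then obtain x where "x \<in> N" "elts x = {s. s \<in>\<^sub>E omega \<and> (\<exists>p\<in>G. s = s)}"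
    using definable_in_N[of omega "\<lambda>s p. s = s"] hf_num by (auto simp: E_omega)
  then show "\<exists>w\<in>N. elts w = range num"
    using G_Nil by (auto simp: elts_eq_iff E_omega)
qed

end

section \<open>An antichain along the generic branch\<close>

context zfc_model
begin

text \<open>\<open>sibling s p\<close> says that \<open>s\<close> and \<open>p\<close> extend the same node by the digit 0 and 1,
  respectively.\<close>

definition sibling :: "'a \<Rightarrow> 'a \<Rightarrow> bool" where
  "sibling s p \<longleftrightarrow> (\<exists>q\<in>M. \<exists>n\<in>M. \<exists>w\<in>M. \<exists>a\<in>M. \<exists>b\<in>M. \<exists>x\<in>M. \<exists>y\<in>M.
     is_natural n \<and> is_omega w \<and> is_function q n w \<and>
     is_empty a \<and> is_succ a b \<and> is_opair n a x \<and> is_opair n b y \<and>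
     (\<forall>t\<in>M. t \<in>\<^sub>E s \<longleftrightarrow> t \<in>\<^sub>E q \<or> t = x) \<and> (\<forall>t\<in>M. t \<in>\<^sub>E p \<longleftrightarrow> t \<in>\<^sub>E q \<or> t = y))"

lemma definable_sibling [dfb]: "definable (\<lambda>\<rho>. sibling (\<rho> i) (\<rho> j))"
  unfolding sibling_def by (intro dfb)

lemma enc_snoc_iff:
  assumes "s \<in> M"
  shows "(\<forall>t\<in>M. t \<in>\<^sub>E s \<longleftrightarrow> t \<in>\<^sub>E enc xs \<or> t = opair (num (length xs)) (num k)) \<longleftrightarrow> s = enc (xs @ [k])"
proof -
  have "(\<forall>t\<in>M. t \<in>\<^sub>E s \<longleftrightarrow> t \<in>\<^sub>E enc xs \<or> t = opair (num (length xs)) (num k)) \<longleftrightarrow>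
      elts s = insert (opair (num (length xs)) (num k)) (elts (enc xs))"
    using assms E_in_M enc_in_M by (auto simp: elts_eq_iff)
  then show ?thesis
    unfolding elts_enc_snoc[symmetric] elts_inject .
qed

lemma sibling_iff:
  assumes s: "s \<in> M" and p: "p \<in> M"
  shows "sibling s p \<longleftrightarrow> (\<exists>xs. s = enc (xs @ [0]) \<and> p = enc (xs @ [1]))"
proof
  assume "sibling s p"
  then obtain q n w a b x y where M: "q \<in> M" "n \<in> M" "w \<in> M" "a \<in> M" "b \<in> M" "x \<in> M" "y \<in> M"
    and q: "is_natural n" "is_omega w" "is_function q n w"
    and xy: "is_empty a" "is_succ a b" "is_opair n a x" "is_opair n b y"
    and sp: "\<forall>t\<in>M. t \<in>\<^sub>E s \<longleftrightarrow> t \<in>\<^sub>E q \<or> t = x" "\<forall>t\<in>M. t \<in>\<^sub>E p \<longleftrightarrow> t \<in>\<^sub>E q \<or> t = y"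
    unfolding sibling_def by (elim bexE conjE)
  obtain k where k: "n = num k"
    using q(1) is_natural_iff by blast
  then obtain xs where xs: "length xs = k" "q = enc xs"
    using q M is_omega_iff is_function_iff by blast
  have a: "a = num 0"
    using xy(1) M by (simp add: is_empty_iff)
  then have b: "b = num 1"
    using xy(2) M is_succ_num[of b 0] by simp
  have x: "x = opair (num (length xs)) (num 0)" and y: "y = opair (num (length xs)) (num 1)"
    using xy(3,4) M a b k xs is_opair_iff by blast+
  have "s = enc (xs @ [0])"
    using sp(1) enc_snoc_iff[OF s, of xs 0] unfolding x xs(2) by (rule iffD1[rotated])
  moreover have "p = enc (xs @ [1])"
    using sp(2) enc_snoc_iff[OF p, of xs 1] unfolding y xs(2) by (rule iffD1[rotated])
  ultimately show "\<exists>xs. s = enc (xs @ [0]) \<and> p = enc (xs @ [1])"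
    by blast
next
  assume "\<exists>xs. s = enc (xs @ [0]) \<and> p = enc (xs @ [1])"
  then obtain xs where xs: "s = enc (xs @ [0])" "p = enc (xs @ [1])"
    by blast
  let ?n = "num (length xs)"
  have "is_natural ?n" "is_omega omega" "is_function (enc xs) ?n omega"
    by (simp_all add: is_natural_iff is_omega_iff is_function_enc)
  moreover have "is_empty (num 0)" "is_succ (num 0) (num 1)"
      "is_opair ?n (num 0) (opair ?n (num 0))" "is_opair ?n (num 1) (opair ?n (num 1))"
    using is_empty_num_0 is_succ_num[of "num 1" 0] num_in_M opair_in_M is_opair_iff by auto
  moreover have "\<forall>t\<in>M. t \<in>\<^sub>E s \<longleftrightarrow> t \<in>\<^sub>E enc xs \<or> t = opair ?n (num 0)"
    using enc_snoc_iff[OF s] xs(1) by blast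
  moreover have "\<forall>t\<in>M. t \<in>\<^sub>E p \<longleftrightarrow> t \<in>\<^sub>E enc xs \<or> t = opair ?n (num 1)"
    using enc_snoc_iff[OF p] xs(2) by blast
  ultimately show "sibling s p"
    unfolding sibling_def using enc_in_M num_in_M omega_in_M opair_in_M[OF num_in_M num_in_M] by blast
qed

end

section \<open>Genericity arguments\<close>

context seq_extension
begin

text \<open>If only finitely many \<open>xs @ [1]\<close> were on the generic branch,
  \<open>M\<close> could define the set of all other nodes ending in 1. That set is dense but misses
  \<open>G\<close>.\<close>

lemma infinite_siblings: "infinite {xs. enc (xs @ [1]) \<in> G}"
proof
  assume fin: "finite {xs. enc (xs @ [1]) \<in> G}"
  \<comment> \<open>The finite exception set is coded by the siblings ending in 0, because
    \<open>sibling\<close> lets \<open>M\<close> refer to those; being finite, it is represented in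
    \<open>M\<close>.\<close>
  define S where "S = (\<lambda>xs. enc (xs @ [0])) ` {xs. enc (xs @ [1]) \<in> G}"
  have S: "finite S" "S \<subseteq> M"
    unfolding S_def using fin by auto
  have F: "mk S \<in> M" "\<And>xs. enc (xs @ [0]) \<in>\<^sub>E mk S \<longleftrightarrow> enc (xs @ [1]) \<in> G"
    using S by (simp_all add: image_iff) (auto simp: S_def)
  obtain P where P: "P \<in> M" "elts P = range enc"
    using nodes_in_M by blast
  define Q where "Q p F \<longleftrightarrow> (\<exists>s\<in>M. sibling s p \<and> \<not> s \<in>\<^sub>E F)" for p F
  have "definable (\<lambda>\<rho>. Q (\<rho> 0) (\<rho> 1))"
    unfolding Q_def by (intro dfb)
  then obtain D where D: "D \<in> M" "elts D = {p. p \<in>\<^sub>E P \<and> Q p (mk S)}"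
    by (rule sep[where Q = "\<lambda>p F _ _. Q p F", OF _ P(1) F(1) F(1) F(1)]) blast
  have ED: "enc ys \<in>\<^sub>E D \<longleftrightarrow> (\<exists>xs. ys = xs @ [1] \<and> enc ys \<notin> G)" for ys
  proof -
    have "enc ys \<in>\<^sub>E P"
      using P(2) in_elts by blast
    then have "enc ys \<in>\<^sub>E D \<longleftrightarrow> Q (enc ys) (mk S)"
      using D(2) in_elts by blast
    also have "\<dots> \<longleftrightarrow> (\<exists>xs. ys = xs @ [1] \<and> enc ys \<notin> G)"
      unfolding Q_def using F(2) by (auto simp: sibling_iff)
    finally show ?thesis .
  qed
  obtain xs where "enc xs \<in> G" "enc xs \<in>\<^sub>E D"
  proof (rule G_dense[OF D(1)])
    show "elts D \<subseteq> range enc"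
      using D(2) P(2) in_elts by blast
    fix xs :: "nat list"
    \<comment> \<open>Appending blocks of zeros yields infinitely many extensions of
      \<open>xs\<close>, so for one of them the further digit 1 leaves \<open>G\<close>.\<close>
    have "inj (\<lambda>n. xs @ replicate n (0 :: nat))"
      by (auto intro!: injI dest: arg_cong[of _ _ length])
    then have "infinite (range (\<lambda>n. xs @ replicate n (0 :: nat)))"
      using finite_imageD infinite_UNIV_nat by blast
    then have "\<not> range (\<lambda>n. xs @ replicate n 0) \<subseteq> {xs. enc (xs @ [1]) \<in> G}"
      using fin finite_subset by blast
    then obtain n where "enc ((xs @ replicate n 0) @ [1]) \<notin> G"
      by blast
    then have "enc ((xs @ replicate n 0) @ [1]) \<in>\<^sub>E D"
      unfolding ED by blast
    moreover have "prefix xs ((xs @ replicate n 0) @ [1])"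
      by simp
    ultimately show "\<exists>ys. prefix xs ys \<and> enc ys \<in>\<^sub>E D"
      by blast
  qed
  then show False
    unfolding ED by blast
qed

text \<open>Comparable nodes of equal length coincide, so a bound on the lengths would leave only
  finitely many nodes \<open>xs @ [1]\<close> in \<open>G\<close>.\<close>

lemma G_unbounded: "\<exists>xs. enc xs \<in> G \<and> k \<le> length xs"
proof (rule ccontr)
  assume contra: "\<not> ?thesis"
  let ?H = "{xs. enc (xs @ [1]) \<in> G}"
  have "length ` ?H \<subseteq> {..<k}"
    using contra by force
  moreover have "inj_on length ?H"
  proof (rule inj_onI)
    fix xs ys assume "xs \<in> ?H" "ys \<in> ?H" and len: "length xs = length ys"
    then have "prefix (xs @ [1]) (ys @ [1]) \<or> prefix (ys @ [1]) (xs @ [1])"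
      using G_comparable by blast
    then show "xs = ys"
      using len by (auto simp: prefix_def)
  qed
  ultimately show False
    using infinite_siblings inj_on_finite by blast
qed

text \<open>Otherwise \<open>ys\<close> has digit 0 at position \<open>length xs\<close>. But
  \<open>xs @ [1]\<close> and \<open>ys @ [1]\<close> are comparable members of \<open>G\<close>,
  and the shorter one demands digit 1 there.\<close>

lemma G_antichain:
  assumes "enc (xs @ [1]) \<in> G" "enc (ys @ [1]) \<in> G" "prefix (xs @ [0]) (ys @ [0])"
  shows "xs = ys"
proof (rule ccontr)
  assume "xs \<noteq> ys"
  then have "prefix (xs @ [0]) ys"
    using assms(3) by auto
  then have 0: "prefix (xs @ [0]) (ys @ [1])"
    by (simp add: prefix_prefix)
  have "length xs < length ys"
    using prefix_length_le[OF \<open>prefix (xs @ [0]) ys\<close>] by simp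
  then have "\<not> prefix (ys @ [1]) (xs @ [1])"
    using prefix_length_le by fastforce
  then have "prefix (xs @ [1]) (ys @ [1])"
    using G_comparable assms by blast
  then show False
    using prefix_same_cases[OF 0] by fastforce
qed

lemma not_maximal:
  assumes Off: "Off \<in> M"
  shows "\<not> set_structure.maximal_off_branch_family N E Off"
proof -
  interpret N: omega_model N E
    by (rule extension_omega_model)
  obtain P where P: "P \<in> M" "elts P = range enc"
    using nodes_in_M by blast
  have EP: "s \<in>\<^sub>E P \<longleftrightarrow> s \<in> range enc" for s
    using P(2) by (simp add: elts_eq_iff)
  have hfP: "hf s" if "s \<in>\<^sub>E P" for s
    using that hf_enc by (auto simp: EP)
  have "definable (\<lambda>\<rho>. \<rho> i = \<rho> j)" for i j
    by (rule dfb)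
  \<comment> \<open>Taking equality as the relation makes \<open>G\<close> itself an element of
    \<open>N\<close>: this is the generic branch.\<close>
  then obtain B where B: "B \<in> N" "elts B = {s. s \<in>\<^sub>E P \<and> (\<exists>p\<in>G. s = p)}"
    using definable_in_N[OF P(1) hfP] by blast
  then have EB: "elts B = G"
    using G_enc EP by blast
  have "definable (\<lambda>\<rho>. sibling (\<rho> i) (\<rho> j))" for i j
    by (rule dfb)
  then obtain X where X: "X \<in> N" "elts X = {s. s \<in>\<^sub>E P \<and> (\<exists>p\<in>G. sibling s p)}"
    using definable_in_N[OF P(1) hfP] by blast
  have EX: "elts X = (\<lambda>xs. enc (xs @ [0])) ` {xs. enc (xs @ [1]) \<in> G}" (is "_ = ?X")
  proof -
    have "s \<in>\<^sub>E P \<and> (\<exists>p\<in>G. sibling s p) \<longleftrightarrow> s \<in> ?X" for s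
      using G_in_M EP by (auto simp: sibling_iff)
    then show ?thesis
      unfolding X(2) by blast
  qed
  have chain_iff: "N.chain C \<longleftrightarrow> (\<exists>L. elts C = enc ` L \<and> (\<forall>xs\<in>L. \<forall>ys\<in>L. prefix xs ys \<or> prefix ys xs))"
    if "C \<in> N" for C
  proof
    assume C: "N.chain C"
    then have "elts C \<subseteq> range enc"
      using N.node_set_iff[OF that] unfolding N.chain_def by blast
    then have "elts C = enc ` (enc -` elts C)"
      by blast
    moreover have "prefix xs ys \<or> prefix ys xs" if "enc xs \<in>\<^sub>E C" "enc ys \<in>\<^sub>E C" for xs ys
      using C that N.subset_enc_iff N.enc_in_M unfolding N.chain_def by blast
    ultimately show "\<exists>L. elts C = enc ` L \<and> (\<forall>xs\<in>L. \<forall>ys\<in>L. prefix xs ys \<or> prefix ys xs)"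
      by (intro exI[of _ "enc -` elts C"]) auto
  next
    assume "\<exists>L. elts C = enc ` L \<and> (\<forall>xs\<in>L. \<forall>ys\<in>L. prefix xs ys \<or> prefix ys xs)"
    then obtain L where L: "elts C = enc ` L" "\<forall>xs\<in>L. \<forall>ys\<in>L. prefix xs ys \<or> prefix ys xs"
      by blast
    have "N.subset s t \<or> N.subset t s" if st: "s \<in>\<^sub>E C" "t \<in>\<^sub>E C" for s t
    proof -
      have "s \<in> enc ` L" "t \<in> enc ` L"
        unfolding L(1)[symmetric] using st by simp_all
      then obtain xs ys where "s = enc xs" "t = enc ys" "xs \<in> L" "ys \<in> L"
        by blast
      then show ?thesis
        using L(2) N.subset_enc_iff by blast
    qed
    then show "N.chain C"
      using N.node_set_iff[OF that] L(1) unfolding N.chain_def by blast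
  qed
  have "N.off_branch X"
    unfolding N.off_branch_def
  proof (intro conjI ballI impI)
    show "N.node_set X"
      using N.node_set_iff[OF X(1)] EX by blast
    have "inj (\<lambda>xs. enc (xs @ [0]))"
      by (auto intro: injI)
    then show "\<not> N.is_finite X"
      using N.is_finite_iff[OF X(1)] infinite_siblings unfolding EX
      by (metis finite_imageD inj_on_subset subset_UNIV)
  next
    fix C assume C: "C \<in> N" "N.branch C"
    then have "N.chain C"
      unfolding N.branch_def by blast
    then obtain L where L: "elts C = enc ` L" "\<forall>xs\<in>L. \<forall>ys\<in>L. prefix xs ys \<or> prefix ys xs"
      unfolding chain_iff[OF C(1)] by (elim exE conjE)
    \<comment> \<open>Two members of \<open>X\<close> on one branch are comparable, hence equal by
      \<open>G_antichain\<close>.\<close>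
    have "s = t" if st: "s \<in> elts X \<inter> elts C" "t \<in> elts X \<inter> elts C" for s t
    proof -
      obtain xs ys where xy: "s = enc (xs @ [0])" "t = enc (ys @ [0])"
          "enc (xs @ [1]) \<in> G" "enc (ys @ [1]) \<in> G"
        using IntD1[OF st(1)] IntD1[OF st(2)] unfolding EX by (elim imageE CollectE)
      then have "xs @ [0] \<in> L" "ys @ [0] \<in> L"
        using st unfolding L(1) by auto
      then show ?thesis
        using L(2) G_antichain xy by metis
    qed
    then have "finite (elts X \<inter> elts C)"
      by (metis finite.simps subsetI subset_singletonD is_singletonI' finite.emptyI is_singleton_def)
    then show "N.almost_disjoint X C"
      using N.almost_disjoint_iff X(1) C(1) by blast
  qed
  moreover have "N.branch B"
  proof -
    have "G = enc ` {xs. enc xs \<in> G}"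
      using G_enc by blast
    then have "N.chain B"
      unfolding chain_iff[OF B(1)] EB using G_comparable by blast
    moreover have "C = B" if C: "C \<in> N" "N.chain C" "N.subset B C" for C
    proof -
      obtain L where L: "elts C = enc ` L" "\<forall>xs\<in>L. \<forall>ys\<in>L. prefix xs ys \<or> prefix ys xs"
        using C(2) unfolding chain_iff[OF C(1)] by (elim exE conjE)
      have sub: "G \<subseteq> elts C"
        using N.subset_iff[OF B(1)] C(3) EB by simp
      have "enc xs \<in> G" if "xs \<in> L" for xs
      proof -
        \<comment> \<open>Maximality: \<open>C\<close> contains arbitrarily long members of
          \<open>G\<close>, and a node comparable with a longer one is its initial segment.\<close>
        obtain ys where ys: "enc ys \<in> G" "length xs \<le> length ys"
          using G_unbounded by blast
        then have "ys \<in> L"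
          using sub L(1) by auto
        then have "prefix xs ys \<or> prefix ys xs"
          using L(2) that by blast
        then have "prefix xs ys"
          using ys(2) by (metis prefix_length_prefix prefix_order.refl)
        then show ?thesis
          using G_prefix ys(1) by blast
      qed
      then have "elts C \<subseteq> G"
        unfolding L(1) by blast
      then have "elts C = elts B"
        unfolding EB using sub by (rule subset_antisym)
      then show ?thesis
        by (simp add: elts_inject)
    qed
    ultimately show ?thesis
      unfolding N.branch_def by blast
  qed
  moreover have "N.almost_disjoint X A"
    if A: "A \<in> N" "A \<in>\<^sub>E Off" "N.off_branch A" for A
  proof -
    have AM: "A \<in> M"
      using A(2) Off by (rule E_in_M)
    have "N.almost_disjoint A B"
      using A(3) \<open>N.branch B\<close> B(1) unfolding N.off_branch_def by blast
    then have fin: "finite (elts A \<inter> G)"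
      using N.almost_disjoint_iff[OF A(1) B(1)] EB by simp
    \<comment> \<open>Though \<open>G\<close> need not belong to \<open>M\<close>, this finite part
      of it does, so \<open>F\<close> can serve as a parameter for a dense set of
      \<open>M\<close>.\<close>
    define F where "F = mk (elts A \<inter> G)"
    have "elts A \<inter> G \<subseteq> M"
      using G_in_M by blast
    then have F: "F \<in> M" "elts F = elts A \<inter> G"
      using fin by (simp_all add: F_def)
    then have EF: "s \<in>\<^sub>E F \<longleftrightarrow> s \<in>\<^sub>E A \<and> s \<in> G" for s
      by (simp add: elts_eq_iff)
    define Q where "Q p A F \<longleftrightarrow> (p \<in>\<^sub>E A \<and> \<not> p \<in>\<^sub>E F) \<or>
      \<not> (\<exists>s\<in>M. s \<in>\<^sub>E A \<and> \<not> s \<in>\<^sub>E F \<and> subset p s)" for p A F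
    have "definable (\<lambda>\<rho>. Q (\<rho> 0) (\<rho> 1) (\<rho> 2))"
      unfolding Q_def by (intro dfb)
    then obtain D where D: "D \<in> M" "elts D = {p. p \<in>\<^sub>E P \<and> Q p A F}"
      by (rule sep[where Q = "\<lambda>p A F _. Q p A F", OF _ P(1) AM F(1) F(1)]) blast
    have nodes: "elts A \<subseteq> range enc"
      using A(3) N.node_set_iff[OF A(1)] unfolding N.off_branch_def by blast
    have ED: "enc xs \<in>\<^sub>E D \<longleftrightarrow> (enc xs \<in>\<^sub>E A \<and> \<not> enc xs \<in>\<^sub>E F) \<or>
        (\<forall>ys. prefix xs ys \<longrightarrow> enc ys \<in>\<^sub>E A \<longrightarrow> enc ys \<in>\<^sub>E F)" for xs
    proof -
      have "enc xs \<in>\<^sub>E D \<longleftrightarrow> Q (enc xs) A F"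
        using D(2) EP by (simp add: elts_eq_iff)
      moreover have "(\<exists>s\<in>M. s \<in>\<^sub>E A \<and> \<not> s \<in>\<^sub>E F \<and> subset (enc xs) s) \<longleftrightarrow>
          (\<exists>ys. enc ys \<in>\<^sub>E A \<and> \<not> enc ys \<in>\<^sub>E F \<and> prefix xs ys)"
        using nodes subset_enc_iff enc_in_M in_elts by blast
      ultimately show ?thesis
        unfolding Q_def by blast
    qed
    obtain xs where xs: "enc xs \<in> G" "enc xs \<in>\<^sub>E D"
    proof (rule G_dense[OF D(1)])
      show "elts D \<subseteq> range enc"
        using D(2) EP by blast
      \<comment> \<open>Density: if \<open>zs\<close> has an extension in \<open>A\<close> outside
        \<open>F\<close>, that extension belongs to \<open>D\<close>; otherwise \<open>zs\<close>
        itself does.\<close>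
      show "\<exists>ys. prefix zs ys \<and> enc ys \<in>\<^sub>E D" for zs
        unfolding ED by blast
    qed
    \<comment> \<open>The first alternative in \<open>D\<close> is impossible for a member of
      \<open>G\<close>, as \<open>F\<close> already contains all of \<open>A\<close> on the generic
      branch.\<close>
    then have above: "enc ys \<in>\<^sub>E F" if "prefix xs ys" "enc ys \<in>\<^sub>E A" for ys
      using that unfolding ED EF by blast
    \<comment> \<open>A member of \<open>X\<close> either extends \<open>xs\<close>, and is then
      caught by \<open>F\<close>, or splits off from the generic branch below the end of
      \<open>xs\<close>. In the latter case it is obtained from an initial segment of
      \<open>xs\<close> by changing the last digit to 0.\<close>
    have "elts X \<inter> elts A \<subseteq> elts F \<union> enc ` (\<lambda>zs. butlast zs @ [0]) ` {zs. prefix zs xs}"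
    proof
      fix s assume s: "s \<in> elts X \<inter> elts A"
      then obtain ys where ys: "s = enc (ys @ [0])" "enc (ys @ [1]) \<in> G"
        unfolding EX by blast
      show "s \<in> elts F \<union> enc ` (\<lambda>zs. butlast zs @ [0]) ` {zs. prefix zs xs}"
      proof (cases "prefix xs (ys @ [0])")
        case True
        then show ?thesis
          using above s ys by simp
      next
        case False
        then have "\<not> prefix xs ys"
          using prefix_prefix by blast
        moreover have "prefix xs (ys @ [1]) \<or> prefix (ys @ [1]) xs"
          using G_comparable xs(1) ys(2) by blast
        \<comment> \<open>Should \<open>xs\<close> be an initial segment of \<open>ys @ [1]\<close>,
          it equals \<open>ys @ [1]\<close>, since it is not one of \<open>ys\<close>.\<close>
        ultimately have "prefix (ys @ [1]) xs"
          by auto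
        then have "s \<in> enc ` (\<lambda>zs. butlast zs @ [0]) ` {zs. prefix zs xs}"
          using ys(1) by (intro image_eqI[of _ _ "ys @ [0]"] image_eqI[of _ _ "ys @ [1]"]) simp_all
        then show ?thesis
          by blast
      qed
    qed
    moreover have "finite {zs. prefix zs xs}"
      by (metis set_prefixes_eq List.finite_set)
    ultimately have "finite (elts X \<inter> elts A)"
      using fin F(2) by (metis finite_Un finite_imageI finite_subset)
    then show ?thesis
      using N.almost_disjoint_iff X(1) A(1) by blast
  qed
  \<comment> \<open>If all members of \<open>Off\<close> are off-branch in \<open>N\<close>, then
    \<open>X\<close> refutes maximality; if some member is not, \<open>Off\<close> is no off-branch
    family there.\<close>
  ultimately show ?thesis
    using X(1) unfolding N.maximal_off_branch_family_def N.off_branch_family_def by blast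
qed

end

theorem theorem5p1:
  fixes E :: "'a \<Rightarrow> 'a \<Rightarrow> bool"
    and V VG G :: "'a set"
    and Off :: 'a
  assumes wf: "wfp E"
    and ext: "\<And>x y. (\<And>z. E z x \<longleftrightarrow> E z y) \<Longrightarrow> x = y"
    and V_trans: "set_structure.transitive V E"
    and V_ZFC: "set_structure.models_ZFC V E"
    and Off_in_V: "Off \<in> V"
    and Off_family: "set_structure.off_branch_family V E Off"
    and G_generic: "set_structure.generic_filter V E
          (set_structure.seq_poset V E) (set_structure.seq_le V E) G"
    and VG: "set_structure.is_generic_extension V E (set_structure.seq_poset V E) G VG"
  shows "\<not> set_structure.maximal_off_branch_family VG E Off"
proof -
  interpret seq_extension V E G VG
    by unfold_locales (fact wf V_trans V_ZFC G_generic VG | rule ext, assumption)+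
  show ?thesis
    using Off_in_V by (rule not_maximal)
qed

end
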